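(* Let $\Omega \subset \mathbb{R}^d$ be open and bounded. Let $T$ be a bounded self-adjoint operator on $L_2(\Omega)$. Then the following are equivalent. (i) There exists a $K \in C(\overline{\Omega} \times \overline{\Omega})$ such that $(T^2 u)(x) = \int_\Omega K(x,y)\, u(y)\, dy$ for all $u \in L_2(\Omega)$ and almost every $x \in \Omega$. (ii) $T L_2(\Omega) \subset C(\overline{\Omega})$ and the operator $T \colon L_2(\Omega) \to C(\overline{\Omega})$ is compact.
   Context: $L_2(\Omega)$ is the complex Hilbert space of (classes of) square-integrable functions on $\Omega$ with Lebesgue measure, and $C(\overline{\Omega})$ is the space of complex-valued continuous functions on $\overline{\Omega}$ with the supremum norm. The inclusion $T L_2(\Omega) \subset C(\overline{\Omega})$ means that for every $u \in L_2(\Omega)$ the element $Tu$ has a representative on $\Omega$ which extends to a (necessarily unique) continuous function on $\overline{\Omega}$; $Tu$ is identified with this continuous function, and in this way $T$ is viewed as an operator from $L_2(\Omega)$ into $C(\overline{\Omega})$. *)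

theory Defs
  imports "HOL-Analysis.Analysis"
begin

section \<open>The complex space of square-integrable functions\<close>

text \<open>Functions are total on the ambient Euclidean space, but only their values on
  \<open>\<Omega>\<close> matter: all measure-theoretic conditions refer to \<open>lebesgue_on \<Omega>\<close>. Elements of
  \<open>L2 \<Omega>\<close> are equivalence classes modulo equality almost everywhere on \<open>\<Omega>\<close>.\<close>

definition square_integrable :: "'a::euclidean_space set \<Rightarrow> ('a \<Rightarrow> complex) set" where
  "square_integrable \<Omega> = {f. f \<in> borel_measurable (lebesgue_on \<Omega>) \<and>
                             integrable (lebesgue_on \<Omega>) (\<lambda>x. (cmod (f x))\<^sup>2)}"

definition ae_eq_rel :: "'a::euclidean_space set \<Rightarrow> (('a \<Rightarrow> complex) \<times> ('a \<Rightarrow> complex)) set" where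
  "ae_eq_rel \<Omega> = {(f, g). f \<in> square_integrable \<Omega> \<and> g \<in> square_integrable \<Omega> \<and>
                          (AE x in lebesgue_on \<Omega>. f x = g x)}"

definition L2 :: "'a::euclidean_space set \<Rightarrow> ('a \<Rightarrow> complex) set set" where
  "L2 \<Omega> = square_integrable \<Omega> // ae_eq_rel \<Omega>"

definition L2_class :: "'a::euclidean_space set \<Rightarrow> ('a \<Rightarrow> complex) \<Rightarrow> ('a \<Rightarrow> complex) set" where
  "L2_class \<Omega> f = ae_eq_rel \<Omega> `` {f}"

definition L2_rep :: "('a::euclidean_space \<Rightarrow> complex) set \<Rightarrow> 'a \<Rightarrow> complex" where
  "L2_rep u = (SOME f. f \<in> u)"

definition L2_add ::
    "'a::euclidean_space set \<Rightarrow> ('a \<Rightarrow> complex) set \<Rightarrow> ('a \<Rightarrow> complex) set \<Rightarrow> ('a \<Rightarrow> complex) set" where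
  "L2_add \<Omega> u v = L2_class \<Omega> (\<lambda>x. L2_rep u x + L2_rep v x)"

definition L2_scale ::
    "'a::euclidean_space set \<Rightarrow> complex \<Rightarrow> ('a \<Rightarrow> complex) set \<Rightarrow> ('a \<Rightarrow> complex) set" where
  "L2_scale \<Omega> c u = L2_class \<Omega> (\<lambda>x. c * L2_rep u x)"

definition L2_inner ::
    "'a::euclidean_space set \<Rightarrow> ('a \<Rightarrow> complex) set \<Rightarrow> ('a \<Rightarrow> complex) set \<Rightarrow> complex" where
  "L2_inner \<Omega> u v = (LINT x|lebesgue_on \<Omega>. L2_rep u x * cnj (L2_rep v x))"

definition L2_norm :: "'a::euclidean_space set \<Rightarrow> ('a \<Rightarrow> complex) set \<Rightarrow> real" where
  "L2_norm \<Omega> u = sqrt (LINT x|lebesgue_on \<Omega>. (cmod (L2_rep u x))\<^sup>2)"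

lemma equiv_ae_eq_rel: "equiv (square_integrable \<Omega>) (ae_eq_rel \<Omega>)"
proof (rule equivI)
  show "ae_eq_rel \<Omega> \<subseteq> square_integrable \<Omega> \<times> square_integrable \<Omega>"
    by (auto simp: ae_eq_rel_def)
  show "refl_on (square_integrable \<Omega>) (ae_eq_rel \<Omega>)"
    by (auto simp: refl_on_def ae_eq_rel_def)
  show "sym (ae_eq_rel \<Omega>)"
    by (auto simp: sym_def ae_eq_rel_def)
  show "trans (ae_eq_rel \<Omega>)"
    unfolding trans_def ae_eq_rel_def by auto
qed

lemma L2_class_in_L2: "f \<in> square_integrable \<Omega> \<Longrightarrow> L2_class \<Omega> f \<in> L2 \<Omega>"
  by (auto simp: L2_def L2_class_def quotient_def)

lemma L2_rep_in: "u \<in> L2 \<Omega> \<Longrightarrow> L2_rep u \<in> u"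
  unfolding L2_rep_def L2_def
  by (metis equiv_ae_eq_rel in_quotient_imp_non_empty some_in_eq)

lemma L2_members:
  assumes "u \<in> L2 \<Omega>" "f \<in> u"
  shows "g \<in> u \<longleftrightarrow> g \<in> square_integrable \<Omega> \<and> (AE x in lebesgue_on \<Omega>. f x = g x)"
proof -
  have "u = ae_eq_rel \<Omega> `` {f}" and "f \<in> square_integrable \<Omega>"
    using assms equiv_ae_eq_rel unfolding L2_def
    by (metis Image_singleton_iff equiv_class_eq quotientE,
        metis in_quotient_imp_subset equiv_ae_eq_rel subsetD)
  then show ?thesis by (auto simp: ae_eq_rel_def)
qed

section \<open>Bounded self-adjoint operators\<close>

definition bounded_operator_L2 ::
    "'a::euclidean_space set \<Rightarrow> (('a \<Rightarrow> complex) set \<Rightarrow> ('a \<Rightarrow> complex) set) \<Rightarrow> bool" where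
  "bounded_operator_L2 \<Omega> T \<longleftrightarrow>
     (\<forall>u\<in>L2 \<Omega>. T u \<in> L2 \<Omega>) \<and>
     (\<forall>u\<in>L2 \<Omega>. \<forall>v\<in>L2 \<Omega>. T (L2_add \<Omega> u v) = L2_add \<Omega> (T u) (T v)) \<and>
     (\<forall>c. \<forall>u\<in>L2 \<Omega>. T (L2_scale \<Omega> c u) = L2_scale \<Omega> c (T u)) \<and>
     (\<exists>C. \<forall>u\<in>L2 \<Omega>. L2_norm \<Omega> (T u) \<le> C * L2_norm \<Omega> u)"

definition self_adjoint_L2 ::
    "'a::euclidean_space set \<Rightarrow> (('a \<Rightarrow> complex) set \<Rightarrow> ('a \<Rightarrow> complex) set) \<Rightarrow> bool" where
  "self_adjoint_L2 \<Omega> T \<longleftrightarrow>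
     (\<forall>u\<in>L2 \<Omega>. \<forall>v\<in>L2 \<Omega>. L2_inner \<Omega> (T u) v = L2_inner \<Omega> u (T v))"

section \<open>Operators into the continuous functions on the closure\<close>

text \<open>For bounded \<open>\<Omega>\<close>, the points of this metric space are all continuous functions on
  \<open>closure \<Omega>\<close> (set to \<open>undefined\<close> outside it), and its distance is the supremum distance.\<close>

definition C_closure :: "'a::euclidean_space set \<Rightarrow> ('a \<Rightarrow> complex) metric" where
  "C_closure \<Omega> = cfunspace (top_of_set (closure \<Omega>)) euclidean_metric"

definition L2_subset_C :: "'a::euclidean_space set \<Rightarrow> ('a \<Rightarrow> complex) set set \<Rightarrow> bool" where
  "L2_subset_C \<Omega> U \<longleftrightarrow> (\<forall>u\<in>U. \<exists>g\<in>mspace (C_closure \<Omega>). g \<in> u)"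

text \<open>For open \<open>\<Omega>\<close> there is at most one such \<open>g\<close>; see \<open>cont_rep_eqI\<close> below.\<close>

definition cont_rep :: "'a::euclidean_space set \<Rightarrow> ('a \<Rightarrow> complex) set \<Rightarrow> 'a \<Rightarrow> complex" where
  "cont_rep \<Omega> u = (THE g. g \<in> mspace (C_closure \<Omega>) \<and> g \<in> u)"

definition compact_operator_L2 ::
    "'a::euclidean_space set \<Rightarrow> 'b metric \<Rightarrow> (('a \<Rightarrow> complex) set \<Rightarrow> 'b) \<Rightarrow> bool" where
  "compact_operator_L2 \<Omega> M S \<longleftrightarrow>
     S ` L2 \<Omega> \<subseteq> mspace M \<and>
     (\<forall>B\<subseteq>L2 \<Omega>. (\<exists>C. \<forall>u\<in>B. L2_norm \<Omega> u \<le> C) \<longrightarrow>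
        compactin (mtopology_of M) (mtopology_of M closure_of (S ` B)))"

lemma mspace_C_closure:
  assumes "bounded \<Omega>"
  shows "g \<in> mspace (C_closure \<Omega>) \<longleftrightarrow> g \<in> extensional (closure \<Omega>) \<and> continuous_on (closure \<Omega>) g"
proof -
  have "bounded (g ` closure \<Omega>)" if "continuous_on (closure \<Omega>) g"
    using that assms by (intro compact_imp_bounded compact_continuous_image) auto
  moreover have "Metric_space.mbounded UNIV dist (g ` closure \<Omega>) \<longleftrightarrow> bounded (g ` closure \<Omega>)"
    by (auto simp: Met_TC.mbounded_def bounded_def Met_TC.mcball_def subset_iff)
  ultimately show ?thesis by (auto simp: C_closure_def)
qed

lemma cont_rep_eqI:
  assumes "open \<Omega>" "u \<in> L2 \<Omega>" "bounded \<Omega>" "g \<in> mspace (C_closure \<Omega>)" "g \<in> u"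
  shows "cont_rep \<Omega> u = g"
  unfolding cont_rep_def
proof (rule the_equality)
  fix h assume h: "h \<in> mspace (C_closure \<Omega>) \<and> h \<in> u"
  have cont: "continuous_on (closure \<Omega>) (\<lambda>x. h x - g x)"
    using h assms by (auto simp: mspace_C_closure intro!: continuous_intros)
  have "AE x in lebesgue_on \<Omega>. h x = g x"
    using L2_members assms h by blast
  then have "AE x in lebesgue. x \<in> \<Omega> \<longrightarrow> h x = g x"
    using assms by (subst (asm) AE_restrict_space_iff) auto
  then obtain N where N: "{x. \<not> (x \<in> \<Omega> \<longrightarrow> h x = g x)} \<subseteq> N" "N \<in> null_sets lebesgue"
    by (elim AE_E3) (auto simp: subset_iff)
  let ?A = "{x\<in>\<Omega>. h x - g x \<noteq> 0}"
  have "continuous_on \<Omega> (\<lambda>x. h x - g x)"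
    using cont closure_subset continuous_on_subset by blast
  then have "open ?A"
    using continuous_open_preimage[of \<Omega> "\<lambda>x. h x - g x" "- {0}"] assms
    by (auto simp: vimage_def Int_def)
  moreover have "negligible ?A"
    using N by (auto simp: negligible_iff_null_sets intro: null_sets_completion_subset)
  ultimately have "?A = {}"
    using open_not_negligible by blast
  then have "h x - g x = 0" if "x \<in> closure \<Omega>" for x
    using continuous_constant_on_closure[OF cont _ that] by blast
  then show "h = g"
    using h assms by (intro extensionalityI[of _ "closure \<Omega>"]) (auto simp: mspace_C_closure)
qed (use assms in auto)

end

theory Submission
  imports Defs "HOL-Complex_Analysis.Great_Picard"
begin

text \<open>
  Write \<open>\<phi>\<^sub>A\<close> for the normalised indicator of a set \<open>A\<close> of positive measure, so that the mean of
  \<open>T u\<close> over \<open>A\<close> is \<open>\<langle>T u, \<phi>\<^sub>A\<rangle> = \<langle>u, T \<phi>\<^sub>A\<rangle>\<close>. Both conditions say that \<open>T (\<phi>\<^sub>A - \<phi>\<^sub>B)\<close> is small in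
  \<open>L\<^sub>2\<close> whenever \<open>A\<close> and \<open>B\<close> lie close together. Given a continuous kernel for \<open>T\<^sup>2\<close>, this follows
  from \<open>\<parallel>T \<psi>\<parallel>\<^sup>2 = \<langle>T\<^sup>2 \<psi>, \<psi>\<rangle>\<close> and uniform continuity of the kernel; the means of \<open>T u\<close> over
  shrinking sets then converge to a continuous representative whose modulus of continuity depends
  only on \<open>\<parallel>u\<parallel>\<close>, and Arzela-Ascoli gives compactness. Conversely, compactness makes the images of
  the unit ball equicontinuous, so that \<open>T\<^sup>2 \<phi>\<^sub>A\<close> converges uniformly as \<open>A\<close> shrinks to \<open>x\<close>, and the
  complex conjugate of the limit is \<open>K(x, \<cdot>)\<close>. Working with these limits rather than with the
  Riesz representation of \<open>u \<mapsto> (T u)(x)\<close> avoids the completeness of \<open>L\<^sub>2\<close>.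
\<close>

section \<open>Relatively compact sets of continuous functions\<close>

text \<open>The condition \<open>0 \<le> e\<close> covers an empty closure, where the distance is
  zero and the pointwise bound is vacuous.\<close>

lemma mdist_C_closure_le_iff:
  assumes "f \<in> mspace (C_closure \<Omega>)" "g \<in> mspace (C_closure \<Omega>)" "0 \<le> e"
  shows "mdist (C_closure \<Omega>) f g \<le> e \<longleftrightarrow> (\<forall>x\<in>closure \<Omega>. dist (f x) (g x) \<le> e)"
proof
  assume "mdist (C_closure \<Omega>) f g \<le> e"
  then show "\<forall>x\<in>closure \<Omega>. dist (f x) (g x) \<le> e"
    using mdist_cfunspace_imp_mdist_le[OF assms(1,2)[unfolded C_closure_def], of e]
    by (auto simp: C_closure_def)
next
  assume "\<forall>x\<in>closure \<Omega>. dist (f x) (g x) \<le> e"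
  then show "mdist (C_closure \<Omega>) f g \<le> e"
    unfolding C_closure_def using assms(3) by (intro mdist_cfunspace_le) auto
qed

text \<open>A set with compact closure is totally bounded, so up to a uniform error it consists of
  finitely many continuous functions. Each of these is bounded and uniformly continuous on the
  compact closure of the domain, and finitely many share a bound and a modulus of
  continuity.\<close>

lemma compact_closure_imp_equicontinuous:
  assumes "bounded \<Omega>" and F: "F \<subseteq> mspace (C_closure \<Omega>)"
    and "compactin (mtopology_of (C_closure \<Omega>)) (mtopology_of (C_closure \<Omega>) closure_of F)"
  shows "\<exists>C. \<forall>f\<in>F. \<forall>x\<in>closure \<Omega>. norm (f x) \<le> C"
    and "e > 0 \<Longrightarrow> \<exists>d>0. \<forall>f\<in>F. \<forall>x\<in>closure \<Omega>. \<forall>y\<in>closure \<Omega>. dist x y < d \<longrightarrow> dist (f x) (f y) \<le> e"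
proof -
  interpret X: Metric_space "mspace (C_closure \<Omega>)" "mdist (C_closure \<Omega>)"
    by simp
  have tb: "X.mtotally_bounded F"
    using X.compact_closure_of_imp_mtotally_bounded assms by (auto simp: mtopology_of_def)
  \<comment> \<open>The centres of the net lie in \<open>F\<close> itself and are therefore
    continuous.\<close>
  have net: "\<exists>K. finite K \<and> K \<subseteq> F \<and> (\<forall>f\<in>F. \<exists>k\<in>K. \<forall>x\<in>closure \<Omega>. dist (k x) (f x) \<le> e)"
    if "e > 0" for e
  proof -
    obtain K where K: "finite K" "K \<subseteq> F" "F \<subseteq> (\<Union>k\<in>K. X.mball k e)"
      using tb \<open>e > 0\<close> unfolding X.mtotally_bounded_def by metis
    have "\<exists>k\<in>K. \<forall>x\<in>closure \<Omega>. dist (k x) (f x) \<le> e" if "f \<in> F" for f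
    proof -
      from K(3) that have "f \<in> (\<Union>k\<in>K. X.mball k e)" by (rule subsetD)
      then obtain k where "k \<in> K" "f \<in> X.mball k e" by (rule UN_E)
      then have "\<forall>x\<in>closure \<Omega>. dist (k x) (f x) \<le> e"
        using mdist_C_closure_le_iff[of k \<Omega> f e] \<open>e > 0\<close> by simp
      with \<open>k \<in> K\<close> show ?thesis by (intro bexI[of _ k])
    qed
    with K show ?thesis by blast
  qed
  have comp: "compact (closure \<Omega>)" using assms by simp
  have cont: "continuous_on (closure \<Omega>) f" if "f \<in> F" for f
    using that F assms by (auto simp: mspace_C_closure subset_iff)
  show "\<exists>C. \<forall>f\<in>F. \<forall>x\<in>closure \<Omega>. norm (f x) \<le> C"
  proof -
    obtain K where K: "finite K" "K \<subseteq> F"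
      "\<And>f. f \<in> F \<Longrightarrow> \<exists>k\<in>K. \<forall>x\<in>closure \<Omega>. dist (k x) (f x) \<le> 1"
      using net[of 1] by auto
    have "bounded (\<Union>k\<in>K. k ` closure \<Omega>)"
      using K comp cont
      by (intro bounded_UN) (auto intro!: compact_imp_bounded compact_continuous_image)
    then obtain C where C: "\<And>k x. k \<in> K \<Longrightarrow> x \<in> closure \<Omega> \<Longrightarrow> norm (k x) \<le> C"
      unfolding bounded_iff by fastforce
    have "norm (f x) \<le> C + 1" if f: "f \<in> F" and x: "x \<in> closure \<Omega>" for f x
    proof -
      obtain k where "k \<in> K" "dist (k x) (f x) \<le> 1" using K(3)[OF f] x by auto
      with C[of k x] x norm_triangle_sub[of "f x" "k x"] show ?thesis
        by (simp add: dist_norm norm_minus_commute)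
    qed
    then show ?thesis by blast
  qed
  show "\<exists>d>0. \<forall>f\<in>F. \<forall>x\<in>closure \<Omega>. \<forall>y\<in>closure \<Omega>. dist x y < d \<longrightarrow> dist (f x) (f y) \<le> e" if "e > 0"
  proof -
    obtain K where K: "finite K" "K \<subseteq> F"
      "\<And>f. f \<in> F \<Longrightarrow> \<exists>k\<in>K. \<forall>x\<in>closure \<Omega>. dist (k x) (f x) \<le> e / 3"
      using net[of "e / 3"] \<open>e > 0\<close> by auto
    have "\<forall>k\<in>K. \<forall>\<^sub>F d in at_right 0.
        \<forall>x\<in>closure \<Omega>. \<forall>y\<in>closure \<Omega>. dist x y < d \<longrightarrow> dist (k x) (k y) < e / 3"
    proof
      fix k assume "k \<in> K"
      with K(2) have "k \<in> F" by (rule subsetD)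
      then have "uniformly_continuous_on (closure \<Omega>) k"
        by (intro compact_uniformly_continuous cont comp)
      then obtain d where "d > 0"
        "\<forall>x\<in>closure \<Omega>. \<forall>y\<in>closure \<Omega>. dist y x < d \<longrightarrow> dist (k y) (k x) < e / 3"
        unfolding uniformly_continuous_on_def
        using divide_pos_pos[OF \<open>e > 0\<close> zero_less_numeral[of "num.Bit1 num.One"]] by meson
      then show "\<forall>\<^sub>F d in at_right 0.
        \<forall>x\<in>closure \<Omega>. \<forall>y\<in>closure \<Omega>. dist x y < d \<longrightarrow> dist (k x) (k y) < e / 3"
        unfolding eventually_at_right_field by (intro exI[of _ d]) auto
    qed
    \<comment> \<open>Each centre works for all sufficiently small \<open>d\<close>; a finite
      conjunction of such statements replaces taking the minimum of the individual radii.\<close>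
    then have "\<forall>\<^sub>F d in at_right (0::real). d > 0 \<and> (\<forall>k\<in>K.
        \<forall>x\<in>closure \<Omega>. \<forall>y\<in>closure \<Omega>. dist x y < d \<longrightarrow> dist (k x) (k y) < e / 3)"
      using K(1) by (intro eventually_conj eventually_ball_finite eventually_at_right_less) auto
    then obtain d where d: "d > 0" "\<And>k x y. k \<in> K \<Longrightarrow> x \<in> closure \<Omega> \<Longrightarrow> y \<in> closure \<Omega> \<Longrightarrow>
        dist x y < d \<Longrightarrow> dist (k x) (k y) < e / 3"
      using eventually_happens'[OF trivial_limit_at_right_real] by (metis (mono_tags, lifting))
    have "dist (f x) (f y) \<le> e"
      if f: "f \<in> F" and xy: "x \<in> closure \<Omega>" "y \<in> closure \<Omega>" "dist x y < d" for f x y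
    proof -
      obtain k where k: "k \<in> K" "dist (k x) (f x) \<le> e / 3" "dist (k y) (f y) \<le> e / 3"
        using K(3)[OF f] xy by auto
      with d(2)[OF k(1) xy] dist_triangle[of "f x" "f y" "k x"] dist_triangle[of "k x" "f y" "k y"]
      show ?thesis by (simp add: dist_commute)
    qed
    with d(1) show ?thesis by blast
  qed
qed

text \<open>Arzela-Ascoli extracts a uniformly convergent subsequence from every sequence in
  \<open>F\<close>. This makes \<open>F\<close> totally bounded, and in a complete space the closure
  of a totally bounded set is compact.\<close>

lemma equicontinuous_imp_compact_closure:
  assumes "bounded \<Omega>" and F: "F \<subseteq> mspace (C_closure \<Omega>)"
    and bd: "\<And>f x. f \<in> F \<Longrightarrow> x \<in> closure \<Omega> \<Longrightarrow> norm (f x) \<le> C"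
    and equi: "\<And>e. e > 0 \<Longrightarrow> \<exists>d>0. \<forall>f\<in>F. \<forall>x\<in>closure \<Omega>. \<forall>y\<in>closure \<Omega>.
                  dist x y < d \<longrightarrow> dist (f x) (f y) \<le> e"
  shows "compactin (mtopology_of (C_closure \<Omega>)) (mtopology_of (C_closure \<Omega>) closure_of F)"
proof -
  interpret X: Metric_space "mspace (C_closure \<Omega>)" "mdist (C_closure \<Omega>)"
    by simp
  \<comment> \<open>Completeness of the complex numbers passes to the bounded continuous functions;
    it remains to identify two names for the usual metric.\<close>
  have "complete (UNIV :: complex set)" by (simp add: complete_UNIV)
  then have "Metric_space.mcomplete (UNIV :: complex set) dist" 
    by (simp add: mcomplete_iff_complete)
  then have "mcomplete_of (cfunspace (top_of_set (closure \<Omega>)) (Met_TC.Self :: complex metric))"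
    by (rule Met_TC.mcomplete_cfunspace)
  moreover have "(Met_TC.Self :: complex metric) = euclidean_metric"
    by (simp add: Met_TC.Self_def euclidean_metric_def)
  ultimately have complete: "X.mcomplete"
    by (simp add: mcomplete_of_def C_closure_def)
  have "\<exists>r. strict_mono r \<and> X.MCauchy (\<sigma> \<circ> r)" if \<sigma>: "range \<sigma> \<subseteq> F" for \<sigma> :: "nat \<Rightarrow> _"
  proof -
    have \<sigma>F: "\<sigma> n \<in> F" for n using \<sigma> by auto
    obtain g r where r: "strict_mono (r :: nat \<Rightarrow> nat)"
      and lim: "\<And>e. 0 < e \<Longrightarrow> \<exists>N. \<forall>n x. n \<ge> N \<and> x \<in> closure \<Omega> \<longrightarrow> norm (\<sigma> (r n) x - g x) < e"
    proof (rule Arzela_Ascoli[of "closure \<Omega>" \<sigma> C])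
      show "compact (closure \<Omega>)" using assms by simp
      show "norm (\<sigma> n x) \<le> C" if "x \<in> closure \<Omega>" for n x using bd \<sigma>F that by blast
      show "\<exists>d. 0 < d \<and> (\<forall>n y. y \<in> closure \<Omega> \<and> norm (x - y) < d \<longrightarrow> norm (\<sigma> n x - \<sigma> n y) < e)"
        if "x \<in> closure \<Omega>" "0 < e" for x e
      proof -
        obtain d where "d > 0" and d: "\<forall>f\<in>F. \<forall>x\<in>closure \<Omega>. \<forall>y\<in>closure \<Omega>.
            dist x y < d \<longrightarrow> dist (f x) (f y) \<le> e / 2"
          using equi[OF half_gt_zero[OF \<open>0 < e\<close>]] by (elim exE conjE)
        have "norm (\<sigma> n x - \<sigma> n y) < e" if "y \<in> closure \<Omega>" "norm (x - y) < d" for n y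
          using d[rule_format, OF \<sigma>F[of n] \<open>x \<in> closure \<Omega>\<close> that(1)] that(2) \<open>0 < e\<close>
          by (simp add: dist_norm)
        with \<open>d > 0\<close> show ?thesis by blast
      qed
    qed (use that in blast)
    \<comment> \<open>Two late members are compared through \<open>g\<close>, at a cost of
      \<open>e / 4\<close> each. The resulting non-strict bound \<open>e / 2\<close> for the
      supremum distance is strictly below \<open>e\<close>.\<close>
    have "X.MCauchy (\<sigma> \<circ> r)"
      unfolding X.MCauchy_def
    proof (intro conjI allI impI)
      show "range (\<sigma> \<circ> r) \<subseteq> mspace (C_closure \<Omega>)" using \<sigma>F F by auto
      fix e :: real assume "e > 0"
      then obtain N where N: "\<And>n x. n \<ge> N \<Longrightarrow> x \<in> closure \<Omega> \<Longrightarrow> norm (\<sigma> (r n) x - g x) < e / 4"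
        using lim[of "e / 4"] by auto
      have "mdist (C_closure \<Omega>) ((\<sigma> \<circ> r) n) ((\<sigma> \<circ> r) n') < e" if "N \<le> n" "N \<le> n'" for n n'
      proof -
        have "dist (\<sigma> (r n) x) (\<sigma> (r n') x) \<le> e / 2" if x: "x \<in> closure \<Omega>" for x
          using N[OF \<open>N \<le> n\<close> x] N[OF \<open>N \<le> n'\<close> x]
            dist_triangle2[of "\<sigma> (r n) x" "\<sigma> (r n') x" "g x"] by (simp add: dist_norm)
        then have "mdist (C_closure \<Omega>) ((\<sigma> \<circ> r) n) ((\<sigma> \<circ> r) n') \<le> e / 2"
          using \<sigma>F F \<open>e > 0\<close> by (subst mdist_C_closure_le_iff) auto
        with \<open>e > 0\<close> show ?thesis by simp
      qed
      then show "\<exists>N. \<forall>n n'. N \<le> n \<longrightarrow> N \<le> n' \<longrightarrow> mdist (C_closure \<Omega>) ((\<sigma> \<circ> r) n) ((\<sigma> \<circ> r) n') < e"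
        by blast
    qed
    with r show ?thesis by blast
  qed
  then have "X.mtotally_bounded F"
    using F by (simp add: X.mtotally_bounded_sequentially)
  then show ?thesis
    using X.mtotally_bounded_eq_compact_closure_of[OF complete] by (simp add: mtopology_of_def)
qed

section \<open>Continuous representatives from averages\<close>

locale bounded_open =
  fixes \<Omega> :: "'a::euclidean_space set"
  assumes open_dom: "open \<Omega>" and bounded_dom: "bounded \<Omega>"
begin

lemma dom_lmeasurable: "\<Omega> \<in> lmeasurable"
  by (simp add: lmeasurable_open open_dom bounded_dom)

lemma sets_dom [simp, measurable]: "\<Omega> \<in> sets lebesgue"
  using dom_lmeasurable by (simp add: fmeasurableD)

sublocale finite_measure "lebesgue_on \<Omega>"
  by (rule finite_measure_lebesgue_on[OF dom_lmeasurable])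

lemma compact_closure_dom: "compact (closure \<Omega>)"
  using bounded_dom by simp

section \<open>Averages over sets of positive measure\<close>

definition pos_sets :: "'a set set" where
  "pos_sets = {A \<in> sets (lebesgue_on \<Omega>). 0 < measure (lebesgue_on \<Omega>) A}"

lemma pos_setsD:
  assumes "A \<in> pos_sets"
  shows "A \<in> sets (lebesgue_on \<Omega>)" "A \<subseteq> \<Omega>" "0 < measure (lebesgue_on \<Omega>) A" "A \<noteq> {}"
  using assms sets.sets_into_space[of A "lebesgue_on \<Omega>"] by (auto simp: pos_sets_def)

text \<open>A ball about a point of the closure meets \<Omega> in a nonempty open set, which is not
  negligible. Hence boundary points, too, are limits of shrinking sets over which averages
  exist.\<close>

lemma ball_Int_in_pos_sets:
  assumes "x \<in> closure \<Omega>" "0 < r"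
  shows "\<Omega> \<inter> ball x r \<in> pos_sets"
proof -
  have "\<Omega> \<inter> ball x r \<noteq> {}"
    using assms by (metis Int_commute centre_in_ball open_Int_closure_eq_empty open_ball disjoint_iff)
  moreover have "open (\<Omega> \<inter> ball x r)" using open_dom by auto
  ultimately have "\<Omega> \<inter> ball x r \<notin> null_sets lebesgue"
    using open_not_negligible by (metis negligible_iff_null_sets)
  moreover have "\<Omega> \<inter> ball x r \<in> lmeasurable"
    using dom_lmeasurable by (simp add: fmeasurable.Int)
  ultimately have "0 < measure lebesgue (\<Omega> \<inter> ball x r)"
    by (metis fmeasurableD fmeasurableD2 measure_nonneg emeasure_eq_measure2 emeasure_eq_ennreal_measure
        ennreal_0 less_eq_real_def null_setsI)
  then show ?thesis
    by (auto simp: pos_sets_def measure_restrict_space sets_restrict_space_iff)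
qed

definition avg :: "'a set \<Rightarrow> ('a \<Rightarrow> complex) \<Rightarrow> complex" where
  "avg A f = (1 / measure (lebesgue_on \<Omega>) A) *\<^sub>R set_lebesgue_integral (lebesgue_on \<Omega>) A f"

lemma avg_cong_AE:
  assumes "AE x in lebesgue_on \<Omega>. f x = g x"
    and "f \<in> borel_measurable (lebesgue_on \<Omega>)" "g \<in> borel_measurable (lebesgue_on \<Omega>)"
    and "A \<in> pos_sets"
  shows "avg A f = avg A g"
proof -
  have [measurable]: "A \<in> sets (lebesgue_on \<Omega>)" using pos_setsD assms by auto
  note [measurable] = assms(2,3)
  have "set_lebesgue_integral (lebesgue_on \<Omega>) A f = set_lebesgue_integral (lebesgue_on \<Omega>) A g"
    unfolding set_lebesgue_integral_def using assms(1)
    by (intro integral_cong_AE) auto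
  then show ?thesis by (simp add: avg_def)
qed

text \<open>Closed balls are stable under averaging. The bound is assumed only almost everywhere
  because it will be applied to images under the operator, which are known only up to null
  sets.\<close>

lemma dist_avg_le:
  assumes f: "integrable (lebesgue_on \<Omega>) f" and A: "A \<in> pos_sets" 
    and le: "AE x in lebesgue_on \<Omega>. x \<in> A \<longrightarrow> dist (f x) z \<le> e"
  shows "dist (avg A f) z \<le> e"
proof -
  let ?M = "lebesgue_on \<Omega>"
  note A' = pos_setsD[OF A]
  note [measurable] = A'(1)
  have int: "set_integrable ?M A f" "set_integrable ?M A (\<lambda>_. z)" "set_integrable ?M A (\<lambda>_. e)"
    unfolding set_integrable_def using A'(1)
    by (rule integrable_mult_indicator, use f in simp)+
  have "avg A f - z = (1 / measure ?M A) *\<^sub>R set_lebesgue_integral ?M A (\<lambda>x. f x - z)"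
    using int A' by (simp add: avg_def set_integral_diff set_integral_const algebra_simps)
  also have "norm \<dots> \<le> (1 / measure ?M A) * set_lebesgue_integral ?M A (\<lambda>_. e)"
  proof -
    have "norm (set_lebesgue_integral ?M A (\<lambda>x. f x - z)) \<le> (LINT x|?M. norm (indicator A x *\<^sub>R (f x - z)))"
      unfolding set_lebesgue_integral_def by (rule integral_norm_bound)
    also have "\<dots> \<le> (LINT x|?M. indicator A x *\<^sub>R e)"
    proof (rule integral_mono_AE)
      show "integrable ?M (\<lambda>x. norm (indicator A x *\<^sub>R (f x - z)))"
        by (rule integrable_norm)
          (use set_integral_diff(1)[OF int(1,2)] in \<open>simp add: set_integrable_def\<close>)
      show "integrable ?M (\<lambda>x. indicator A x *\<^sub>R e)"
        using int(3) by (simp add: set_integrable_def)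
      show "AE x in ?M. norm (indicator A x *\<^sub>R (f x - z)) \<le> indicator A x *\<^sub>R e"
        using le by eventually_elim (auto simp: dist_norm indicator_def)
    qed
    finally show ?thesis
      using A' by (simp add: set_lebesgue_integral_def divide_right_mono)
  qed
  also have "\<dots> = e" using A' by (simp add: set_integral_const)
  finally show ?thesis by (simp add: dist_norm)
qed

text \<open>The stability of closed balls under averaging is applied twice: over \<open>A\<close>
  with a fixed value \<open>f b\<close> as centre, then over \<open>B\<close> with
  \<open>avg A f\<close> as centre.\<close>

lemma dist_avg_avg_le:
  assumes f: "integrable (lebesgue_on \<Omega>) f" and AB: "A \<in> pos_sets" "B \<in> pos_sets"
    and le: "\<And>a b. a \<in> A \<Longrightarrow> b \<in> B \<Longrightarrow> dist (f a) (f b) \<le> e"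
  shows "dist (avg A f) (avg B f) \<le> e"
proof -
  have "dist (avg A f) (f b) \<le> e" if "b \<in> B" for b
    using le that by (intro dist_avg_le[OF f AB(1)]) auto
  then show ?thesis
    by (subst dist_commute, intro dist_avg_le[OF f AB(2)]) (auto simp: dist_commute)
qed

section \<open>Limits of set functions along shrinking sets\<close>

text \<open>A modulus of continuity for functions of sets. The function \<open>v\<close> is kept
  abstract because two instances occur: averages of an image under the operator, and the value at a
  fixed point of the image of \<open>phi A\<close> under the squared operator.\<close>

definition small_osc :: "('a set \<Rightarrow> complex) \<Rightarrow> real \<Rightarrow> real \<Rightarrow> bool" where
  "small_osc v d e \<longleftrightarrow> (\<forall>A\<in>pos_sets. \<forall>B\<in>pos_sets.
      (\<forall>a\<in>A. \<forall>b\<in>B. dist a b < d) \<longrightarrow> dist (v A) (v B) \<le> e)"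

text \<open>The point function behind \<open>v\<close>. Intersecting the balls with \<Omega> makes
  sense of it on the boundary as well.\<close>

definition shrink_lim :: "('a set \<Rightarrow> complex) \<Rightarrow> 'a \<Rightarrow> complex" where
  "shrink_lim v x = lim (\<lambda>n. v (\<Omega> \<inter> ball x (1 / Suc n)))"

text \<open>Any two points in balls of radius below \<open>d / 2\<close> about \<open>x\<close> are
  less than \<open>d\<close> apart, so the values of \<open>v\<close> form a Cauchy
  sequence.\<close>

lemma shrink_lim_tendsto:
  assumes v: "\<And>e. 0 < e \<Longrightarrow> \<exists>d>0. small_osc v d e" and x: "x \<in> closure \<Omega>"
  shows "(\<lambda>n. v (\<Omega> \<inter> ball x (1 / Suc n))) \<longlonglongrightarrow> shrink_lim v x"
proof -
  have "Cauchy (\<lambda>n. v (\<Omega> \<inter> ball x (1 / Suc n)))"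
  proof (rule metric_CauchyI)
    fix e :: real assume "0 < e"
    then obtain d where d: "0 < d" "small_osc v d (e / 2)" using v[of "e / 2"] by auto
    obtain N :: nat where N: "1 / Suc N < d / 2"
      using d nat_approx_posE[of "d / 2"] by (metis half_gt_zero)
    have "dist (v (\<Omega> \<inter> ball x (1 / Suc m))) (v (\<Omega> \<inter> ball x (1 / Suc n))) < e"
      if "N \<le> m" "N \<le> n" for m n
    proof -
      have mn: "1 / Suc m \<le> 1 / Suc N" "1 / Suc n \<le> 1 / Suc N"
        using that by (auto intro!: divide_left_mono)
      have "dist a b < d" if "dist x a < 1 / Suc m" "dist x b < 1 / Suc n" for a b
        using that mn N dist_triangle3[of a b x] by linarith
      then have "dist (v (\<Omega> \<inter> ball x (1 / Suc m))) (v (\<Omega> \<inter> ball x (1 / Suc n))) \<le> e / 2"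
        using d(2) x by (auto simp: small_osc_def ball_Int_in_pos_sets)
      with \<open>0 < e\<close> show ?thesis by simp
    qed
    then show "\<exists>N. \<forall>m\<ge>N. \<forall>n\<ge>N. dist (v (\<Omega> \<inter> ball x (1 / Suc m))) (v (\<Omega> \<inter> ball x (1 / Suc n))) < e"
      by blast
  qed
  then show ?thesis
    unfolding shrink_lim_def by (simp add: Cauchy_convergent_iff convergent_LIMSEQ_iff)
qed

lemma eventually_ball_radius_less: "0 < r \<Longrightarrow> \<forall>\<^sub>F n in sequentially. 1 / real (Suc n) < r"
  using order_tendstoD(2)[OF LIMSEQ_inverse_real_of_nat] by (simp add: inverse_eq_divide)

text \<open>The gap \<open>d - r\<close> leaves room for the shrinking balls: once their radius is
  below it, their points are closer than \<open>d\<close> to all points of \<open>A\<close>, and the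
  bound passes to the limit.\<close>

lemma dist_shrink_lim_le:
  assumes v: "\<And>e. 0 < e \<Longrightarrow> \<exists>d>0. small_osc v d e" and x: "x \<in> closure \<Omega>"
    and osc: "small_osc v d e" and A: "A \<in> pos_sets"
    and r: "r < d" "\<And>a. a \<in> A \<Longrightarrow> dist a x \<le> r"
  shows "dist (v A) (shrink_lim v x) \<le> e"
proof (rule tendsto_upperbound)
  show "(\<lambda>n. dist (v A) (v (\<Omega> \<inter> ball x (1 / Suc n)))) \<longlonglongrightarrow> dist (v A) (shrink_lim v x)"
    by (intro tendsto_intros shrink_lim_tendsto v x)
  show "\<forall>\<^sub>F n in sequentially. dist (v A) (v (\<Omega> \<inter> ball x (1 / Suc n))) \<le> e"
    using eventually_ball_radius_less[of "d - r", OF diff_gt_0_iff_gt[THEN iffD2, OF r(1)]]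
  proof eventually_elim
    case (elim n)
    have "dist a b < d" if "a \<in> A" "dist x b < 1 / Suc n" for a b
      using elim r that dist_triangle[of a b x] by fastforce
    then show ?case
      using osc A x by (auto simp: small_osc_def ball_Int_in_pos_sets)
  qed
qed simp

lemma dist_shrink_lim_shrink_lim_le:
  assumes v: "\<And>e. 0 < e \<Longrightarrow> \<exists>d>0. small_osc v d e" and xy: "x \<in> closure \<Omega>" "y \<in> closure \<Omega>"
    and osc: "small_osc v d e" and d: "dist x y < d"
  shows "dist (shrink_lim v x) (shrink_lim v y) \<le> e"
proof (rule tendsto_upperbound)
  show "(\<lambda>n. dist (v (\<Omega> \<inter> ball x (1 / Suc n))) (shrink_lim v y))
      \<longlonglongrightarrow> dist (shrink_lim v x) (shrink_lim v y)"
    by (intro tendsto_intros shrink_lim_tendsto v xy)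
  show "\<forall>\<^sub>F n in sequentially. dist (v (\<Omega> \<inter> ball x (1 / Suc n))) (shrink_lim v y) \<le> e"
    using eventually_ball_radius_less[OF diff_gt_0_iff_gt[THEN iffD2, OF d]]
  proof eventually_elim
    case (elim n)
    have "dist a y \<le> dist x y + 1 / Suc n" if "a \<in> \<Omega> \<inter> ball x (1 / Suc n)" for a
      using that dist_triangle3[of a y x] by simp
    then show ?case
      using elim by (intro dist_shrink_lim_le[OF v xy(2) osc _, of _ "dist x y + 1 / Suc n"])
        (auto simp: ball_Int_in_pos_sets xy)
  qed
qed simp

lemma continuous_on_shrink_lim:
  assumes v: "\<And>e. 0 < e \<Longrightarrow> \<exists>d>0. small_osc v d e"
  shows "continuous_on (closure \<Omega>) (shrink_lim v)"
  unfolding continuous_on_iff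
proof (intro ballI allI impI)
  fix x and e :: real assume x: "x \<in> closure \<Omega>" and "0 < e"
  then obtain d where d: "0 < d" "small_osc v d (e / 2)" using v[of "e / 2"] by auto
  then show "\<exists>d>0. \<forall>x'\<in>closure \<Omega>. dist x' x < d \<longrightarrow> dist (shrink_lim v x') (shrink_lim v x) < e"
    using dist_shrink_lim_shrink_lim_le[OF v _ x d(2)] \<open>0 < e\<close> by (intro exI[of _ d]) fastforce
qed

lemma norm_shrink_lim_le:
  assumes v: "\<And>e. 0 < e \<Longrightarrow> \<exists>d>0. small_osc v d e" and x: "x \<in> closure \<Omega>"
    and le: "\<And>A. A \<in> pos_sets \<Longrightarrow> norm (v A) \<le> C"
  shows "norm (shrink_lim v x) \<le> C"
proof (rule tendsto_upperbound)
  show "(\<lambda>n. norm (v (\<Omega> \<inter> ball x (1 / Suc n)))) \<longlonglongrightarrow> norm (shrink_lim v x)"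
    by (intro tendsto_intros shrink_lim_tendsto v x)
qed (use x le in \<open>auto simp: ball_Int_in_pos_sets\<close>)

text \<open>This takes the place of Lebesgue differentiation. On a small ball all averages of
  \<open>f\<close> lie near one value, hence so does \<open>f\<close> almost everywhere; finitely
  many such balls cover the compact closure.\<close>

lemma AE_eq_shrink_lim:
  assumes f: "integrable (lebesgue_on \<Omega>) f"
    and v: "\<And>e. 0 < e \<Longrightarrow> \<exists>d>0. small_osc (\<lambda>A. avg A f) d e"
  shows "AE x in lebesgue_on \<Omega>. f x = shrink_lim (\<lambda>A. avg A f) x"
proof -
  let ?g = "shrink_lim (\<lambda>A. avg A f)"
  have AE_le: "AE x in lebesgue_on \<Omega>. dist (f x) (?g x) \<le> 2 * e" if "0 < e" for e
  proof -
    obtain d where d: "0 < d" "small_osc (\<lambda>A. avg A f) d e" using v[OF \<open>0 < e\<close>] by auto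
    obtain F where F: "finite F" "F \<subseteq> closure \<Omega>" "closure \<Omega> \<subseteq> (\<Union>c\<in>F. ball c (d / 2))"
    proof (rule compactE_image[OF compact_closure_dom])
      show "closure \<Omega> \<subseteq> (\<Union>c\<in>closure \<Omega>. ball c (d / 2))" using d by auto
    qed auto
    have "AE x in lebesgue_on \<Omega>. x \<in> ball c (d / 2) \<longrightarrow> dist (f x) (?g c) \<le> e" if c: "c \<in> F" for c
    proof -
      let ?U = "\<Omega> \<inter> ball c (d / 2)"
      have U: "?U \<in> sets lebesgue" "?U \<in> lmeasurable"
        using dom_lmeasurable by (auto intro: fmeasurable.Int)
      interpret U: finite_measure "lebesgue_on ?U"
        by (rule finite_measure_lebesgue_on[OF U(2)])
      \<comment> \<open>If the averages of a function over all sets of positive measure lie in a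
        closed set, then so do almost all of its values. The closed set here is a ball about
        \<open>?g c\<close>.\<close>
      have "AE x in lebesgue_on ?U. f x \<in> cball (?g c) e"
      proof (rule U.averaging_theorem)
        have "integrable lebesgue (\<lambda>x. indicator (ball c (d / 2)) x *\<^sub>R indicator \<Omega> x *\<^sub>R f x)"
          using integrable_mult_indicator[of "ball c (d / 2)" lebesgue "\<lambda>x. indicator \<Omega> x *\<^sub>R f x"] f
          by (simp add: integrable_restrict_space)
        then show "integrable (lebesgue_on ?U) f"
          using U by (simp add: integrable_restrict_space indicator_inter_arith mult.commute)
        fix A assume A: "A \<in> sets (lebesgue_on ?U)" "0 < measure (lebesgue_on ?U) A"
        then have A': "A \<in> sets lebesgue" "A \<subseteq> ?U" using U by (auto simp: sets_restrict_space_iff)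
        have meas: "measure (lebesgue_on ?U) A = measure (lebesgue_on \<Omega>) A"
          using A' U by (simp add: measure_restrict_space)
        then have pos: "A \<in> pos_sets"
          using A A' by (auto simp: pos_sets_def sets_restrict_space_iff)
        \<comment> \<open>For subsets of \<open>?U\<close>, averaging with respect to
          \<open>lebesgue_on ?U\<close> and to \<open>lebesgue_on \<Omega>\<close> is the
          same.\<close>
        have "set_lebesgue_integral (lebesgue_on ?U) A f
            = set_lebesgue_integral lebesgue A (\<lambda>x. indicator ?U x *\<^sub>R f x)"
          using U(1) by (simp add: set_integral_restrict_space)
        also have "\<dots> = set_lebesgue_integral lebesgue A (\<lambda>x. indicator \<Omega> x *\<^sub>R f x)"
          unfolding set_lebesgue_integral_def using A'
          by (intro Bochner_Integration.integral_cong) (auto simp: indicator_def)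
        also have "\<dots> = set_lebesgue_integral (lebesgue_on \<Omega>) A f"
          by (simp add: set_integral_restrict_space)
        finally have "(1 / measure (lebesgue_on ?U) A) *\<^sub>R set_lebesgue_integral (lebesgue_on ?U) A f = avg A f"
          by (simp add: avg_def meas)
        moreover have "dist (avg A f) (?g c) \<le> e"
        proof (rule dist_shrink_lim_le[OF v _ d(2) pos, of _ "d / 2"])
          show "dist a c \<le> d / 2" if "a \<in> A" for a
            using that A' by (force simp: dist_commute)
        qed (use c F d in auto)
        ultimately show "(1 / measure (lebesgue_on ?U) A) *\<^sub>R set_lebesgue_integral (lebesgue_on ?U) A f \<in> cball (?g c) e"
          by (simp add: dist_commute)
      qed simp
      then show ?thesis
        using U(1) by (auto simp: AE_restrict_space_iff dist_commute elim!: eventually_mono)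
    qed
    then have "AE x in lebesgue_on \<Omega>. \<forall>c\<in>F. x \<in> ball c (d / 2) \<longrightarrow> dist (f x) (?g c) \<le> e"
      using F(1) by (intro AE_finite_allI) auto
    with AE_space show ?thesis
    proof eventually_elim
      case (elim x)
      then have x: "x \<in> closure \<Omega>" using closure_subset by auto
      then obtain c where c: "c \<in> F" "x \<in> ball c (d / 2)" using F by auto
      have "dist (?g c) (?g x) \<le> e"
        using c d F by (intro dist_shrink_lim_shrink_lim_le[OF v _ x d(2)]) auto
      with c elim dist_triangle[of "f x" "?g x" "?g c"] show ?case by fastforce
    qed
  qed
  \<comment> \<open>Countably many tolerances keep the union of the exceptional sets null.\<close>
  have "AE x in lebesgue_on \<Omega>. \<forall>n. dist (f x) (?g x) \<le> 2 * (1 / Suc n)"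
    unfolding AE_all_countable by (intro allI AE_le) simp
  then show ?thesis
  proof eventually_elim
    case (elim x)
    have "(\<lambda>n. 2 * (1 / real (Suc n))) \<longlonglongrightarrow> 0"
      using tendsto_mult_right_zero[OF LIMSEQ_inverse_real_of_nat, of 2] by (simp add: inverse_eq_divide)
    then have "dist (f x) (?g x) \<le> 0"
      by (rule tendsto_lowerbound) (use elim in auto)
    then show ?case by simp
  qed
qed

end

section \<open>Square-integrable functions and their classes\<close>

text \<open>Inner product and norm of functions instead of classes, so that the estimates below
  never have to choose representatives.\<close>

definition ip :: "'a::euclidean_space set \<Rightarrow> ('a \<Rightarrow> complex) \<Rightarrow> ('a \<Rightarrow> complex) \<Rightarrow> complex" where
  "ip \<Omega> f g = (LINT x|lebesgue_on \<Omega>. f x * cnj (g x))"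

definition nrm :: "'a::euclidean_space set \<Rightarrow> ('a \<Rightarrow> complex) \<Rightarrow> real" where
  "nrm \<Omega> f = sqrt (LINT x|lebesgue_on \<Omega>. (cmod (f x))\<^sup>2)"

lemma square_integrableD:
  assumes "f \<in> square_integrable \<Omega>"
  shows "f \<in> borel_measurable (lebesgue_on \<Omega>)" "integrable (lebesgue_on \<Omega>) (\<lambda>x. (cmod (f x))\<^sup>2)"
  using assms by (auto simp: square_integrable_def)

text \<open>The product is dominated by the sum of the squares, by the inequality of arithmetic and
  geometric means.\<close>

lemma integrable_mult_cnj:
  assumes f: "f \<in> square_integrable \<Omega>" and g: "g \<in> square_integrable \<Omega>"
  shows "integrable (lebesgue_on \<Omega>) (\<lambda>x. f x * cnj (g x))"
proof (rule Bochner_Integration.integrable_bound)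
  note [measurable] = square_integrableD(1)[OF f] square_integrableD(1)[OF g]
  show "integrable (lebesgue_on \<Omega>) (\<lambda>x. (cmod (f x))\<^sup>2 + (cmod (g x))\<^sup>2)"
    by (intro Bochner_Integration.integrable_add square_integrableD f g)
  have "cnj \<in> borel_measurable borel"
    by (intro borel_measurable_continuous_onI continuous_intros)
  note [measurable] = measurable_compose[OF square_integrableD(1)[OF g] this]
  show "(\<lambda>x. f x * cnj (g x)) \<in> borel_measurable (lebesgue_on \<Omega>)" by measurable
  show "AE x in lebesgue_on \<Omega>. norm (f x * cnj (g x)) \<le> norm ((cmod (f x))\<^sup>2 + (cmod (g x))\<^sup>2)"
  proof (rule AE_I2)
    fix x
    have "2 * (cmod (f x) * cmod (g x)) \<le> (cmod (f x))\<^sup>2 + (cmod (g x))\<^sup>2"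
      using sum_squares_bound[of "cmod (f x)" "cmod (g x)"] by simp
    moreover have "norm (f x * cnj (g x)) = cmod (f x) * cmod (g x)"
      by (simp add: norm_mult)
    ultimately show "norm (f x * cnj (g x)) \<le> norm ((cmod (f x))\<^sup>2 + (cmod (g x))\<^sup>2)"
      using norm_ge_zero[of "f x * cnj (g x)"] unfolding real_norm_def by linarith
  qed
qed

lemma square_integrable_scale:
  assumes "f \<in> square_integrable \<Omega>"
  shows "(\<lambda>x. c * f x) \<in> square_integrable \<Omega>"
  using assms by (auto simp: square_integrable_def norm_mult power_mult_distrib)

lemma square_integrable_diff:
  assumes f: "f \<in> square_integrable \<Omega>" and g: "g \<in> square_integrable \<Omega>"
  shows "(\<lambda>x. f x - g x) \<in> square_integrable \<Omega>"
proof -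
  note [measurable] = square_integrableD(1)[OF f] square_integrableD(1)[OF g]
  have "integrable (lebesgue_on \<Omega>) (\<lambda>x. (cmod (f x - g x))\<^sup>2)"
  proof (rule Bochner_Integration.integrable_bound)
    show "integrable (lebesgue_on \<Omega>) (\<lambda>x. 2 * (cmod (f x))\<^sup>2 + 2 * (cmod (g x))\<^sup>2)"
      by (intro Bochner_Integration.integrable_add integrable_mult_right square_integrableD f g)
    show "AE x in lebesgue_on \<Omega>. norm ((cmod (f x - g x))\<^sup>2) \<le> norm (2 * (cmod (f x))\<^sup>2 + 2 * (cmod (g x))\<^sup>2)"
    proof (rule AE_I2)
      fix x
      have "(cmod (f x - g x))\<^sup>2 \<le> (cmod (f x) + cmod (g x))\<^sup>2"
        by (intro power_mono norm_triangle_ineq4) simp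
      also have "\<dots> \<le> 2 * (cmod (f x))\<^sup>2 + 2 * (cmod (g x))\<^sup>2"
        using sum_squares_bound[of "cmod (f x)" "cmod (g x)"] by (simp add: power2_sum)
      finally show "norm ((cmod (f x - g x))\<^sup>2) \<le> norm (2 * (cmod (f x))\<^sup>2 + 2 * (cmod (g x))\<^sup>2)"
        by simp
    qed
  qed measurable
  then show ?thesis by (simp add: square_integrable_def)
qed

lemma nrm_nonneg [simp]: "0 \<le> nrm \<Omega> f"
  by (simp add: nrm_def)

lemma ip_self: "ip \<Omega> f f = of_real ((nrm \<Omega> f)\<^sup>2)"
proof -
  have "(nrm \<Omega> f)\<^sup>2 = (LINT x|lebesgue_on \<Omega>. (cmod (f x))\<^sup>2)"
    by (simp add: nrm_def)
  then show ?thesis by (simp add: ip_def complex_norm_square[symmetric] flip: integral_complex_of_real)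
qed

lemma nrm_scale: "nrm \<Omega> (\<lambda>x. c * f x) = cmod c * nrm \<Omega> f"
  by (simp add: nrm_def norm_mult power_mult_distrib real_sqrt_mult)

lemma nrm_cong_AE:
  assumes "AE x in lebesgue_on \<Omega>. f x = g x"
    and [measurable]: "f \<in> borel_measurable (lebesgue_on \<Omega>)" "g \<in> borel_measurable (lebesgue_on \<Omega>)"
  shows "nrm \<Omega> f = nrm \<Omega> g"
  unfolding nrm_def using assms(1)
  by (intro arg_cong[where f = sqrt] integral_cong_AE) auto

lemma ip_cong_AE:
  assumes "AE x in lebesgue_on \<Omega>. f x = f' x" "AE x in lebesgue_on \<Omega>. g x = g' x"
    and "f \<in> square_integrable \<Omega>" "f' \<in> square_integrable \<Omega>"
      "g \<in> square_integrable \<Omega>" "g' \<in> square_integrable \<Omega>"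
  shows "ip \<Omega> f g = ip \<Omega> f' g'"
  unfolding ip_def
proof (rule integral_cong_AE)
  show "AE x in lebesgue_on \<Omega>. f x * cnj (g x) = f' x * cnj (g' x)"
    using assms(1,2) by eventually_elim simp
qed (intro borel_measurable_integrable integrable_mult_cnj assms)+

text \<open>Cauchy-Schwarz, obtained from its version for nonnegative extended integrals applied to
  the absolute values.\<close>

lemma norm_ip_le:
  assumes f: "f \<in> square_integrable \<Omega>" and g: "g \<in> square_integrable \<Omega>"
  shows "cmod (ip \<Omega> f g) \<le> nrm \<Omega> f * nrm \<Omega> g"
proof -
  let ?M = "lebesgue_on \<Omega>"
  note [measurable] = square_integrableD(1)[OF f] square_integrableD(1)[OF g]
  define p where "p = (LINT x|?M. cmod (f x) * cmod (g x))"
  define a where "a = (LINT x|?M. (cmod (f x))\<^sup>2)"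
  define b where "b = (LINT x|?M. (cmod (g x))\<^sup>2)"
  have int: "integrable ?M (\<lambda>x. cmod (f x) * cmod (g x))"
    using integrable_norm[OF integrable_mult_cnj[OF f g]] by (simp add: norm_mult)
  have nonneg: "0 \<le> p" "0 \<le> a" "0 \<le> b" by (auto simp: p_def a_def b_def)
  have "(\<integral>\<^sup>+x. ennreal (cmod (f x)) * ennreal (cmod (g x)) \<partial>?M)\<^sup>2
      \<le> (\<integral>\<^sup>+x. (ennreal (cmod (f x)))\<^sup>2 \<partial>?M) * (\<integral>\<^sup>+x. (ennreal (cmod (g x)))\<^sup>2 \<partial>?M)"
    by (rule Cauchy_Schwarz_nn_integral) measurable
  also have "(\<integral>\<^sup>+x. ennreal (cmod (f x)) * ennreal (cmod (g x)) \<partial>?M) = ennreal p"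
    using int by (simp add: p_def nn_integral_eq_integral flip: ennreal_mult')
  also have "(\<integral>\<^sup>+x. (ennreal (cmod (f x)))\<^sup>2 \<partial>?M) = ennreal a"
    using square_integrableD(2)[OF f] by (simp add: a_def nn_integral_eq_integral ennreal_power)
  also have "(\<integral>\<^sup>+x. (ennreal (cmod (g x)))\<^sup>2 \<partial>?M) = ennreal b"
    using square_integrableD(2)[OF g] by (simp add: b_def nn_integral_eq_integral ennreal_power)
  finally have "p\<^sup>2 \<le> a * b"
    using nonneg by (simp add: ennreal_power flip: ennreal_mult')
  then have "p \<le> sqrt a * sqrt b"
    using nonneg by (simp add: real_le_rsqrt flip: real_sqrt_mult)
  moreover have "cmod (ip \<Omega> f g) \<le> p"
    unfolding ip_def p_def using integral_norm_bound[of ?M "\<lambda>x. f x * cnj (g x)"]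
    by (simp add: norm_mult)
  ultimately show ?thesis by (simp add: nrm_def a_def b_def)
qed

text \<open>One factor of the norm cancels. With \<open>f\<close> an image under the operator, this
  turns a bound obtained by duality into a norm bound.\<close>

lemma nrm_le_of_ip_self_le:
  assumes "cmod (ip \<Omega> f f) \<le> e * nrm \<Omega> f" "0 \<le> e"
  shows "nrm \<Omega> f \<le> e"
proof (cases "nrm \<Omega> f = 0")
  case False
  then have "0 < nrm \<Omega> f" using nrm_nonneg[of \<Omega> f] by linarith
  moreover have "nrm \<Omega> f * nrm \<Omega> f \<le> e * nrm \<Omega> f"
    using assms(1) by (simp add: ip_self power2_eq_square norm_mult)
  ultimately show ?thesis by simp
qed (use assms in simp)

section \<open>Passing between classes and their representatives\<close>

lemma mem_L2_class: "f \<in> square_integrable \<Omega> \<Longrightarrow> f \<in> L2_class \<Omega> f"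
  by (simp add: L2_class_def ae_eq_rel_def)

lemma L2_class_eqI:
  assumes "u \<in> L2 \<Omega>" "f \<in> u"
  shows "L2_class \<Omega> f = u"
proof -
  have f: "f \<in> square_integrable \<Omega>" using L2_members[OF assms, of f] assms(2) by simp
  show ?thesis
    by (intro set_eqI)
      (simp add: L2_members[OF assms] L2_members[OF L2_class_in_L2[OF f] mem_L2_class[OF f]])
qed

lemma L2_class_cong:
  assumes "f \<in> square_integrable \<Omega>" "g \<in> square_integrable \<Omega>" "AE x in lebesgue_on \<Omega>. f x = g x"
  shows "L2_class \<Omega> f = L2_class \<Omega> g"
proof -
  have "g \<in> L2_class \<Omega> f"
    using L2_members[OF L2_class_in_L2[OF assms(1)] mem_L2_class[OF assms(1)]] assms by simp
  then show ?thesis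
    using L2_class_eqI[OF L2_class_in_L2[OF assms(1)]] by simp
qed

lemma L2_rep_props:
  assumes "u \<in> L2 \<Omega>" "f \<in> u"
  shows "L2_rep u \<in> square_integrable \<Omega>" "f \<in> square_integrable \<Omega>"
    "AE x in lebesgue_on \<Omega>. L2_rep u x = f x"
  using L2_members[OF assms(1) L2_rep_in[OF assms(1)]] assms L2_rep_in[OF assms(1)] by auto

lemma L2_norm_eq_nrm: "u \<in> L2 \<Omega> \<Longrightarrow> f \<in> u \<Longrightarrow> L2_norm \<Omega> u = nrm \<Omega> f"
  using nrm_cong_AE[of "L2_rep u" f \<Omega>] L2_rep_props[of u \<Omega> f]
  by (simp add: L2_norm_def nrm_def square_integrableD)

lemma L2_inner_eq_ip:
  "u \<in> L2 \<Omega> \<Longrightarrow> f \<in> u \<Longrightarrow> v \<in> L2 \<Omega> \<Longrightarrow> g \<in> v \<Longrightarrow> L2_inner \<Omega> u v = ip \<Omega> f g"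
  using ip_cong_AE[of "L2_rep u" f \<Omega> "L2_rep v" g] L2_rep_props[of u \<Omega> f] L2_rep_props[of v \<Omega> g]
  by (simp add: L2_inner_def ip_def)

lemma L2_scale_class:
  assumes "u \<in> L2 \<Omega>" "f \<in> u"
  shows "L2_scale \<Omega> c u = L2_class \<Omega> (\<lambda>x. c * f x)"
  unfolding L2_scale_def using L2_rep_props[OF assms]
  by (intro L2_class_cong square_integrable_scale) auto

text \<open>Linearity of an operator is stated through \<open>L2_add\<close> and
  \<open>L2_scale\<close>, so a difference is formed as a sum with the multiple by
  \<open>-1\<close>.\<close>

lemma L2_diff_class:
  assumes "u \<in> L2 \<Omega>" "f \<in> u" "v \<in> L2 \<Omega>" "g \<in> v"
  shows "L2_add \<Omega> u (L2_scale \<Omega> (-1) v) = L2_class \<Omega> (\<lambda>x. f x - g x)"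
proof -
  let ?w = "L2_scale \<Omega> (-1) v"
  have sq: "(\<lambda>x. - 1 * g x) \<in> square_integrable \<Omega>"
    using L2_rep_props(2)[OF assms(3,4)] by (rule square_integrable_scale)
  have w: "?w \<in> L2 \<Omega>" "(\<lambda>x. -1 * g x) \<in> ?w"
    using L2_class_in_L2[OF sq] mem_L2_class[OF sq] L2_scale_class[OF assms(3,4)] by auto
  note uu = L2_rep_props[OF assms(1,2)] and vv = L2_rep_props[OF assms(3,4)] and ww = L2_rep_props[OF w]
  have "(\<lambda>x. L2_rep u x - (-1 * L2_rep ?w x)) \<in> square_integrable \<Omega>"
    by (intro square_integrable_diff square_integrable_scale uu ww)
  then show ?thesis
    unfolding L2_add_def
  proof (intro L2_class_cong)
    show "AE x in lebesgue_on \<Omega>. L2_rep u x + L2_rep ?w x = f x - g x"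
      using uu(3) ww(3) by eventually_elim simp
  qed (auto intro: square_integrable_diff uu vv)
qed

section \<open>The operator acting on functions\<close>

locale self_adjoint_operator = bounded_open \<Omega> for \<Omega> :: "'a::euclidean_space set" +
  fixes T :: "('a \<Rightarrow> complex) set \<Rightarrow> ('a \<Rightarrow> complex) set"
  assumes bounded_op: "bounded_operator_L2 \<Omega> T" and self_adj: "self_adjoint_L2 \<Omega> T"
begin

text \<open>The operator carried over to functions by choosing a representative of the image. It is
  therefore linear only up to null sets.\<close>

definition S :: "('a \<Rightarrow> complex) \<Rightarrow> 'a \<Rightarrow> complex" where
  "S f = L2_rep (T (L2_class \<Omega> f))"

abbreviation sq :: "('a \<Rightarrow> complex) set" where
  "sq \<equiv> square_integrable \<Omega>"

lemma T_in_L2: "u \<in> L2 \<Omega> \<Longrightarrow> T u \<in> L2 \<Omega>"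
  using bounded_op by (simp add: bounded_operator_L2_def)

lemma S_in_T: "f \<in> sq \<Longrightarrow> S f \<in> T (L2_class \<Omega> f)"
  unfolding S_def by (rule L2_rep_in[OF T_in_L2[OF L2_class_in_L2]])

lemma S_sq: "f \<in> sq \<Longrightarrow> S f \<in> sq"
  by (rule L2_rep_props(2)[OF T_in_L2[OF L2_class_in_L2] S_in_T])

text \<open>This permits iteration: \<open>S (S f)\<close> represents the image under the squared
  operator.\<close>

lemma L2_class_S: "f \<in> sq \<Longrightarrow> L2_class \<Omega> (S f) = T (L2_class \<Omega> f)"
  by (intro L2_class_eqI S_in_T T_in_L2 L2_class_in_L2)

lemma ip_S:
  assumes f: "f \<in> sq" and g: "g \<in> sq"
  shows "ip \<Omega> (S f) g = ip \<Omega> f (S g)"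
proof -
  have "L2_inner \<Omega> (T (L2_class \<Omega> f)) (L2_class \<Omega> g) = ip \<Omega> (S f) g"
    "L2_inner \<Omega> (L2_class \<Omega> f) (T (L2_class \<Omega> g)) = ip \<Omega> f (S g)"
    by (intro L2_inner_eq_ip T_in_L2 L2_class_in_L2 S_in_T mem_L2_class f g)+
  then show ?thesis
    using self_adj L2_class_in_L2[OF f] L2_class_in_L2[OF g] by (simp add: self_adjoint_L2_def)
qed

lemma S_diff:
  assumes f: "f \<in> sq" and g: "g \<in> sq"
  shows "AE x in lebesgue_on \<Omega>. S (\<lambda>x. f x - g x) x = S f x - S g x"
proof -
  note F = L2_class_in_L2[OF f] mem_L2_class[OF f]
  note G = L2_class_in_L2[OF g] mem_L2_class[OF g]
  have sc: "L2_scale \<Omega> (-1) (L2_class \<Omega> g) \<in> L2 \<Omega>"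
    using L2_scale_class[OF G] g by (metis L2_class_in_L2 square_integrable_scale)
  have "T (L2_class \<Omega> (\<lambda>x. f x - g x)) = L2_add \<Omega> (T (L2_class \<Omega> f)) (L2_scale \<Omega> (-1) (T (L2_class \<Omega> g)))"
    using bounded_op F G sc by (simp add: bounded_operator_L2_def flip: L2_diff_class[OF F G])
  also have "\<dots> = L2_class \<Omega> (\<lambda>x. S f x - S g x)"
    by (intro L2_diff_class T_in_L2 S_in_T F G f g)
  finally have eq: "T (L2_class \<Omega> (\<lambda>x. f x - g x)) = L2_class \<Omega> (\<lambda>x. S f x - S g x)" .
  have sq: "(\<lambda>x. S f x - S g x) \<in> sq" by (intro square_integrable_diff S_sq f g)
  show ?thesis
    unfolding S_def[of "\<lambda>x. f x - g x"] eq
    by (rule L2_rep_props(3)[OF L2_class_in_L2[OF sq] mem_L2_class[OF sq]])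
qed

lemma S_scale:
  assumes f: "f \<in> sq"
  shows "AE x in lebesgue_on \<Omega>. S (\<lambda>x. c * f x) x = c * S f x"
proof -
  note F = L2_class_in_L2[OF f] mem_L2_class[OF f]
  have eq: "T (L2_class \<Omega> (\<lambda>x. c * f x)) = L2_class \<Omega> (\<lambda>x. c * S f x)"
    using bounded_op F L2_scale_class[OF T_in_L2[OF F(1)] S_in_T[OF f]]
    by (simp add: bounded_operator_L2_def flip: L2_scale_class[OF F])
  have sq: "(\<lambda>x. c * S f x) \<in> sq" by (intro square_integrable_scale S_sq f)
  show ?thesis
    unfolding S_def[of "\<lambda>x. c * f x"] eq
    by (rule L2_rep_props(3)[OF L2_class_in_L2[OF sq] mem_L2_class[OF sq]])
qed

end

text \<open>Lets an error tend to zero against a fixed factor. Dividing by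
  \<open>\<bar>M\<bar> + 1\<close> covers every sign of \<open>M\<close>, including zero.\<close>

lemma nonpos_if_le_mult_all:
  fixes a M :: real
  assumes "\<And>e. 0 < e \<Longrightarrow> a \<le> e * M"
  shows "a \<le> 0"
proof (rule field_le_epsilon)
  fix e :: real assume "0 < e"
  have "a \<le> e / (\<bar>M\<bar> + 1) * M" using \<open>0 < e\<close> by (intro assms) simp
  also have "\<dots> \<le> e / (\<bar>M\<bar> + 1) * (\<bar>M\<bar> + 1)" using \<open>0 < e\<close> by (intro mult_left_mono) auto
  finally show "a \<le> 0 + e" by simp
qed

section \<open>Normalised indicators as test functions\<close>

context bounded_open
begin

lemma continuous_on_measurable_dom:
  assumes "continuous_on (closure \<Omega>) f"
  shows "f \<in> borel_measurable (lebesgue_on \<Omega>)"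
  using continuous_on_subset[OF assms closure_subset]
  by (rule continuous_imp_measurable_on_sets_lebesgue) simp

lemma bounded_square_integrable:
  assumes [measurable]: "f \<in> borel_measurable (lebesgue_on \<Omega>)"
    and "\<And>x. x \<in> \<Omega> \<Longrightarrow> cmod (f x) \<le> C"
  shows "f \<in> square_integrable \<Omega>"
proof -
  have "integrable (lebesgue_on \<Omega>) (\<lambda>x. (cmod (f x))\<^sup>2)"
  proof (rule integrable_const_bound)
    show "AE x in lebesgue_on \<Omega>. norm ((cmod (f x))\<^sup>2) \<le> C\<^sup>2"
      using assms(2) by (intro AE_I2) (auto intro!: power_mono)
  qed measurable
  then show ?thesis by (simp add: square_integrable_def)
qed

lemma continuous_square_integrable:
  assumes "continuous_on (closure \<Omega>) f"
  shows "f \<in> square_integrable \<Omega>"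
proof -
  have "bounded (f ` closure \<Omega>)"
    using assms compact_closure_dom by (intro compact_imp_bounded compact_continuous_image)
  then obtain C where "\<forall>x\<in>closure \<Omega>. cmod (f x) \<le> C"
    unfolding bounded_iff by auto
  then show ?thesis
    using closure_subset by (intro bounded_square_integrable[of f C] continuous_on_measurable_dom assms) auto
qed

text \<open>The constant function 1 is square-integrable on the bounded domain, and \<open>f\<close>
  is its product with the conjugate of 1.\<close>

lemma square_integrable_imp_integrable:
  assumes "f \<in> square_integrable \<Omega>"
  shows "integrable (lebesgue_on \<Omega>) f"
  using integrable_mult_cnj[OF assms continuous_square_integrable[OF continuous_on_const, of 1]] by simp

definition phi :: "'a set \<Rightarrow> 'a \<Rightarrow> complex" where
  "phi A x = of_real (indicator A x / measure (lebesgue_on \<Omega>) A)"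

lemma cnj_phi [simp]: "cnj (phi A x) = phi A x"
  by (simp add: phi_def)

lemma phi_square_integrable: "A \<in> pos_sets \<Longrightarrow> phi A \<in> square_integrable \<Omega>"
proof (rule bounded_square_integrable)
  assume "A \<in> pos_sets"
  note A = pos_setsD[OF this]
  note [measurable] = A(1)
  show "phi A \<in> borel_measurable (lebesgue_on \<Omega>)" unfolding phi_def by measurable
  show "cmod (phi A x) \<le> 1 / measure (lebesgue_on \<Omega>) A" for x
    using A(3) by (auto simp: phi_def indicator_def norm_divide)
qed

lemma ip_phi: "ip \<Omega> f (phi A) = avg A f"
proof -
  have "(\<lambda>x. f x * phi A x) = (\<lambda>x. (1 / measure (lebesgue_on \<Omega>) A) *\<^sub>R (indicator A x *\<^sub>R f x))"
    by (auto simp: fun_eq_iff phi_def scaleR_conv_of_real)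
  then show ?thesis
    by (simp only: ip_def avg_def set_lebesgue_integral_def cnj_phi integral_scaleR_right)
qed

lemma ip_phi_diff:
  assumes "f \<in> square_integrable \<Omega>" "A \<in> pos_sets" "B \<in> pos_sets"
  shows "ip \<Omega> f (\<lambda>x. phi A x - phi B x) = avg A f - avg B f"
proof -
  have "ip \<Omega> f (\<lambda>x. phi A x - phi B x) = ip \<Omega> f (phi A) - ip \<Omega> f (phi B)"
    using integrable_mult_cnj[OF assms(1) phi_square_integrable[OF assms(2)]]
      integrable_mult_cnj[OF assms(1) phi_square_integrable[OF assms(3)]]
    by (simp add: ip_def right_diff_distrib)
  then show ?thesis by (simp add: ip_phi)
qed

lemma small_osc_mono: "small_osc v d e \<Longrightarrow> e \<le> e' \<Longrightarrow> small_osc v d e'"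
  unfolding small_osc_def by (meson order_trans)

end

context self_adjoint_operator
begin

text \<open>The difference of averages is a pairing with \<open>phi A - phi B\<close>;
  self-adjointness moves the operator to that side, and Cauchy-Schwarz applies.\<close>

lemma dist_avg_S_le:
  assumes "f \<in> sq" "A \<in> pos_sets" "B \<in> pos_sets"
  shows "dist (avg A (S f)) (avg B (S f)) \<le> nrm \<Omega> f * nrm \<Omega> (S (\<lambda>x. phi A x - phi B x))"
proof -
  have psi: "(\<lambda>x. phi A x - phi B x) \<in> sq"
    by (intro square_integrable_diff phi_square_integrable assms)
  have "dist (avg A (S f)) (avg B (S f)) = cmod (ip \<Omega> f (S (\<lambda>x. phi A x - phi B x)))"
    using assms psi by (simp add: dist_norm ip_phi_diff S_sq flip: ip_S)
  also have "\<dots> \<le> nrm \<Omega> f * nrm \<Omega> (S (\<lambda>x. phi A x - phi B x))"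
    by (intro norm_ip_le S_sq psi assms)
  finally show ?thesis .
qed

text \<open>A converse to the preceding estimate. The squared norm of \<open>S ?psi\<close> is the
  pairing of \<open>S (S ?psi)\<close> with \<open>?psi\<close>, a difference of averages to which
  the hypothesis applies with \<open>f = S ?psi\<close>.\<close>

lemma nrm_S_phi_diff_le:
  assumes "A \<in> pos_sets" "B \<in> pos_sets"
    and "\<And>f. f \<in> sq \<Longrightarrow> dist (avg A (S f)) (avg B (S f)) \<le> e * nrm \<Omega> f" "0 \<le> e"
  shows "nrm \<Omega> (S (\<lambda>x. phi A x - phi B x)) \<le> e"
proof -
  let ?psi = "\<lambda>x. phi A x - phi B x"
  have psi: "?psi \<in> sq"
    by (intro square_integrable_diff phi_square_integrable assms)
  have "ip \<Omega> (S ?psi) (S ?psi) = ip \<Omega> (S (S ?psi)) ?psi"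
    using psi by (simp add: ip_S S_sq)
  also have "\<dots> = avg A (S (S ?psi)) - avg B (S (S ?psi))"
    by (intro ip_phi_diff S_sq psi assms)
  finally have "cmod (ip \<Omega> (S ?psi) (S ?psi)) \<le> e * nrm \<Omega> (S ?psi)"
    using assms(3)[OF S_sq[OF psi]] by (simp add: dist_norm)
  then show ?thesis by (rule nrm_le_of_ip_self_le) fact
qed

section \<open>From the kernel to compactness\<close>

text \<open>The value of \<open>S (S (phi A))\<close> at \<open>x\<close> is the average of the
  kernel section at \<open>x\<close>, so it is bounded by a bound for \<open>K\<close>. Averaging
  once more bounds the squared norm of \<open>S (phi A)\<close>, and duality gives the
  claim.\<close>

lemma kernel_imp_avg_bounded:
  assumes K: "continuous_on (closure \<Omega> \<times> closure \<Omega>) K"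
    and SS: "\<And>f. f \<in> sq \<Longrightarrow> AE x in lebesgue_on \<Omega>. S (S f) x = (LINT y|lebesgue_on \<Omega>. K (x, y) * f y)"
  obtains C where "0 \<le> C" "\<And>f A. f \<in> sq \<Longrightarrow> A \<in> pos_sets \<Longrightarrow> cmod (avg A (S f)) \<le> C * nrm \<Omega> f"
proof -
  have "bounded (K ` (closure \<Omega> \<times> closure \<Omega>))"
    using K compact_closure_dom by (intro compact_imp_bounded compact_continuous_image compact_Times)
  then obtain C where "0 < C" and C: "\<And>x y. x \<in> closure \<Omega> \<Longrightarrow> y \<in> closure \<Omega> \<Longrightarrow> cmod (K (x, y)) \<le> C"
    unfolding bounded_pos by auto
  have "cmod (avg A (S f)) \<le> sqrt C * nrm \<Omega> f" if f: "f \<in> sq" and A: "A \<in> pos_sets" for f A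
  proof -
    have phi: "phi A \<in> sq" by (rule phi_square_integrable[OF A])
    have "AE x in lebesgue_on \<Omega>. x \<in> A \<longrightarrow> dist (S (S (phi A)) x) 0 \<le> C"
      using SS[OF phi] AE_space
    proof eventually_elim
      case (elim x)
      then have x: "x \<in> closure \<Omega>" using closure_subset by auto
      then have "continuous_on (closure \<Omega>) (\<lambda>y. K (x, y))"
        by (intro continuous_on_compose2[OF K] continuous_intros) auto
      then have "integrable (lebesgue_on \<Omega>) (\<lambda>y. K (x, y))"
        by (intro square_integrable_imp_integrable continuous_square_integrable)
      then have "dist (avg A (\<lambda>y. K (x, y))) 0 \<le> C"
        using C[OF x] closure_subset[of \<Omega>] by (intro dist_avg_le A AE_I2) auto
      also have "avg A (\<lambda>y. K (x, y)) = S (S (phi A)) x"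
        using elim by (simp add: ip_def flip: ip_phi)
      finally show ?case by simp
    qed
    then have "dist (avg A (S (S (phi A)))) 0 \<le> C"
      by (intro dist_avg_le A square_integrable_imp_integrable S_sq phi)
    also have "avg A (S (S (phi A))) = ip \<Omega> (S (phi A)) (S (phi A))"
      using phi by (simp add: S_sq flip: ip_phi ip_S)
    finally have "(nrm \<Omega> (S (phi A)))\<^sup>2 \<le> C"
      by (simp add: ip_self norm_power)
    then have le: "nrm \<Omega> (S (phi A)) \<le> sqrt C" by (rule real_le_rsqrt)
    have "cmod (avg A (S f)) = cmod (ip \<Omega> f (S (phi A)))"
      using f phi by (simp flip: ip_phi ip_S)
    also have "\<dots> \<le> nrm \<Omega> f * nrm \<Omega> (S (phi A))"
      by (intro norm_ip_le S_sq f phi)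
    also have "\<dots> \<le> nrm \<Omega> f * sqrt C"
      by (intro mult_left_mono le nrm_nonneg)
    finally show ?thesis by (simp add: mult.commute)
  qed
  then show ?thesis using that[of "sqrt C"] \<open>0 < C\<close> by simp
qed

text \<open>Uniform continuity of the kernel makes \<open>S (S ?psi)\<close> uniformly small for
  \<open>?psi = phi A - phi B\<close> with \<open>A\<close> and \<open>B\<close> close together,
  hence \<open>S ?psi\<close> small in norm. The resulting \<open>d\<close> does not depend on
  \<open>f\<close>.\<close>

lemma kernel_imp_small_osc:
  assumes K: "continuous_on (closure \<Omega> \<times> closure \<Omega>) K"
    and SS: "\<And>f. f \<in> sq \<Longrightarrow> AE x in lebesgue_on \<Omega>. S (S f) x = (LINT y|lebesgue_on \<Omega>. K (x, y) * f y)"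
    and "0 < e"
  obtains d where "0 < d" "\<And>f. f \<in> sq \<Longrightarrow> small_osc (\<lambda>A. avg A (S f)) d (e * nrm \<Omega> f)"
proof -
  have "uniformly_continuous_on (closure \<Omega> \<times> closure \<Omega>) K"
    using K compact_closure_dom by (intro compact_uniformly_continuous compact_Times)
  \<comment> \<open>The averages over \<open>A\<close> and over \<open>B\<close> each contribute
    \<open>e\<^sup>2 / 2\<close> to the squared norm of \<open>S ?psi\<close>, whose root is then at
    most \<open>e\<close>.\<close>
  moreover have "0 < e\<^sup>2 / 2" using \<open>0 < e\<close> by simp
  ultimately obtain d where "0 < d" and d: "\<And>p q. p \<in> closure \<Omega> \<times> closure \<Omega> \<Longrightarrow> q \<in> closure \<Omega> \<times> closure \<Omega>
      \<Longrightarrow> dist q p < d \<Longrightarrow> dist (K q) (K p) < e\<^sup>2 / 2"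
    unfolding uniformly_continuous_on_def by meson
  have "small_osc (\<lambda>A. avg A (S f)) d (e * nrm \<Omega> f)" if f: "f \<in> sq" for f
    unfolding small_osc_def
  proof (intro ballI impI)
    fix A B assume A: "A \<in> pos_sets" and B: "B \<in> pos_sets" and AB: "\<forall>a\<in>A. \<forall>b\<in>B. dist a b < d"
    let ?psi = "\<lambda>x. phi A x - phi B x"
    have psi: "?psi \<in> sq"
      by (intro square_integrable_diff phi_square_integrable A B)
    have AE: "AE x in lebesgue_on \<Omega>. cmod (S (S ?psi) x) \<le> e\<^sup>2 / 2"
      using SS[OF psi] AE_space
    proof eventually_elim
      case (elim x)
      then have x: "x \<in> closure \<Omega>" using closure_subset by auto
      then have "continuous_on (closure \<Omega>) (\<lambda>y. K (x, y))"
        by (intro continuous_on_compose2[OF K] continuous_intros) auto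
      then have sq: "(\<lambda>y. K (x, y)) \<in> sq" by (rule continuous_square_integrable)
      have "S (S ?psi) x = ip \<Omega> (\<lambda>y. K (x, y)) ?psi"
        using elim by (simp add: ip_def)
      also have "\<dots> = avg A (\<lambda>y. K (x, y)) - avg B (\<lambda>y. K (x, y))"
        by (intro ip_phi_diff sq A B)
      finally have "cmod (S (S ?psi) x) = dist (avg A (\<lambda>y. K (x, y))) (avg B (\<lambda>y. K (x, y)))"
        by (simp add: dist_norm)
      also have "\<dots> \<le> e\<^sup>2 / 2"
      proof (rule dist_avg_avg_le[OF square_integrable_imp_integrable[OF sq] A B])
        fix a b assume ab: "a \<in> A" "b \<in> B"
        then have "a \<in> closure \<Omega>" "b \<in> closure \<Omega>"
          using pos_setsD(2)[OF A] pos_setsD(2)[OF B] closure_subset[of \<Omega>] by auto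
        with ab AB x show "dist (K (x, a)) (K (x, b)) \<le> e\<^sup>2 / 2"
          by (intro less_imp_le d) (auto simp: dist_Pair_Pair)
      qed
      finally show ?case .
    qed
    have "dist (avg A' (S (S ?psi))) 0 \<le> e\<^sup>2 / 2" if "A' \<in> pos_sets" for A'
      using AE by (intro dist_avg_le that square_integrable_imp_integrable S_sq psi) (auto elim: eventually_mono)
    from this[OF A] this[OF B] have "cmod (avg A (S (S ?psi)) - avg B (S (S ?psi))) \<le> e\<^sup>2"
      using norm_triangle_ineq4[of "avg A (S (S ?psi))" "avg B (S (S ?psi))"] by simp
    moreover have eq: "ip \<Omega> (S ?psi) (S ?psi) = avg A (S (S ?psi)) - avg B (S (S ?psi))"
      using psi A B by (simp add: S_sq flip: ip_phi_diff ip_S)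
    ultimately have "(nrm \<Omega> (S ?psi))\<^sup>2 \<le> e\<^sup>2"
      by (simp add: ip_self norm_power flip: eq)
    then have "nrm \<Omega> (S ?psi) \<le> e"
      using \<open>0 < e\<close> by (simp add: power2_le_iff_abs_le)
    then have "nrm \<Omega> f * nrm \<Omega> (S ?psi) \<le> nrm \<Omega> f * e"
      by (intro mult_left_mono) auto
    with dist_avg_S_le[OF f A B] show "dist (avg A (S f)) (avg B (S f)) \<le> e * nrm \<Omega> f"
      by (simp add: mult.commute)
  qed
  with \<open>0 < d\<close> show ?thesis by (rule that)
qed

lemma kernel_imp_compact:
  assumes K: "continuous_on (closure \<Omega> \<times> closure \<Omega>) K"
    and SS: "\<And>f. f \<in> sq \<Longrightarrow> AE x in lebesgue_on \<Omega>. S (S f) x = (LINT y|lebesgue_on \<Omega>. K (x, y) * f y)"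
  shows "L2_subset_C \<Omega> (T ` L2 \<Omega>)" "compact_operator_L2 \<Omega> (C_closure \<Omega>) (\<lambda>u. cont_rep \<Omega> (T u))"
proof -
  \<comment> \<open>The candidate for the continuous representative; points of
    \<open>C_closure \<Omega>\<close> are \<open>undefined\<close> off the closure, whence the
    restriction.\<close>
  define G where "G f = restrict (shrink_lim (\<lambda>A. avg A (S f))) (closure \<Omega>)" for f
  have osc: "\<exists>d>0. small_osc (\<lambda>A. avg A (S f)) d e" if "f \<in> sq" "0 < e" for f e
  proof -
    \<comment> \<open>Adding 1 avoids division by zero when \<open>f\<close> vanishes almost
      everywhere.\<close>
    have "0 < e / (nrm \<Omega> f + 1)" using \<open>0 < e\<close> by (intro divide_pos_pos) (auto intro: add_nonneg_pos)
    from kernel_imp_small_osc[OF K SS this] obtain d where d: "0 < d"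
      "\<And>f'. f' \<in> sq \<Longrightarrow> small_osc (\<lambda>A. avg A (S f')) d (e / (nrm \<Omega> f + 1) * nrm \<Omega> f')"
      by blast
    have "e / (nrm \<Omega> f + 1) * nrm \<Omega> f \<le> e / (nrm \<Omega> f + 1) * (nrm \<Omega> f + 1)"
      using \<open>0 < e\<close> by (intro mult_left_mono divide_nonneg_nonneg) auto
    also have "\<dots> = e" using add_nonneg_pos[OF nrm_nonneg zero_less_one, of \<Omega> f] by simp
    finally show ?thesis using d \<open>f \<in> sq\<close> by (blast intro: small_osc_mono)
  qed
  have G: "G f \<in> mspace (C_closure \<Omega>)" "G f \<in> T (L2_class \<Omega> f)" if f: "f \<in> sq" for f
  proof -
    have cont: "continuous_on (closure \<Omega>) (G f)"
      using continuous_on_shrink_lim[OF osc[OF f]] by (simp add: G_def cong: continuous_on_cong)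
    then show "G f \<in> mspace (C_closure \<Omega>)"
      by (simp add: mspace_C_closure bounded_dom G_def)
    have "AE x in lebesgue_on \<Omega>. S f x = shrink_lim (\<lambda>A. avg A (S f)) x"
      by (intro AE_eq_shrink_lim square_integrable_imp_integrable S_sq osc f)
    then have "AE x in lebesgue_on \<Omega>. S f x = G f x"
      using AE_space by eventually_elim (use closure_subset[of \<Omega>] in \<open>auto simp: G_def\<close>)
    then show "G f \<in> T (L2_class \<Omega> f)"
      using L2_members[OF T_in_L2[OF L2_class_in_L2[OF f]] S_in_T[OF f]] continuous_square_integrable[OF cont]
      by simp
  qed
  have rep: "L2_rep u \<in> sq" "T (L2_class \<Omega> (L2_rep u)) = T u" if "u \<in> L2 \<Omega>" for u
    using L2_rep_props[OF that L2_rep_in[OF that]] L2_class_eqI[OF that L2_rep_in[OF that]] by auto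
  show "L2_subset_C \<Omega> (T ` L2 \<Omega>)"
    unfolding L2_subset_C_def using G rep by fastforce
  have cont_rep: "cont_rep \<Omega> (T u) = G (L2_rep u)" if "u \<in> L2 \<Omega>" for u
    using G[OF rep(1)[OF that]] rep(2)[OF that]
    by (intro cont_rep_eqI open_dom bounded_dom T_in_L2 that) auto
  obtain C where C: "0 \<le> C" "\<And>f A. f \<in> sq \<Longrightarrow> A \<in> pos_sets \<Longrightarrow> cmod (avg A (S f)) \<le> C * nrm \<Omega> f"
    using kernel_imp_avg_bounded[OF K SS] by blast
  show "compact_operator_L2 \<Omega> (C_closure \<Omega>) (\<lambda>u. cont_rep \<Omega> (T u))"
    unfolding compact_operator_L2_def
  proof (intro conjI allI impI)
    show "(\<lambda>u. cont_rep \<Omega> (T u)) ` L2 \<Omega> \<subseteq> mspace (C_closure \<Omega>)"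
      using cont_rep G(1) rep(1) by auto
    fix B assume B: "B \<subseteq> L2 \<Omega>" and "\<exists>R. \<forall>u\<in>B. L2_norm \<Omega> u \<le> R"
    then obtain R0 where "\<forall>u\<in>B. L2_norm \<Omega> u \<le> R0" by blast
    then have R: "nrm \<Omega> (L2_rep u) \<le> max R0 1" if "u \<in> B" for u
      using that by (force simp: L2_norm_def nrm_def)
    \<comment> \<open>A strictly positive bound for the norms, so that the tolerance
      \<open>e / R\<close> makes sense below.\<close>
    define R where "R = max R0 1"
    have "0 < R" by (simp add: R_def)
    show "compactin (mtopology_of (C_closure \<Omega>))
        (mtopology_of (C_closure \<Omega>) closure_of ((\<lambda>u. cont_rep \<Omega> (T u)) ` B))"
    proof (rule equicontinuous_imp_compact_closure[OF bounded_dom, where C = "C * R"])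
      show "(\<lambda>u. cont_rep \<Omega> (T u)) ` B \<subseteq> mspace (C_closure \<Omega>)"
        using cont_rep G(1) rep(1) B by auto
      show "norm (f x) \<le> C * R" if f: "f \<in> (\<lambda>u. cont_rep \<Omega> (T u)) ` B" and x: "x \<in> closure \<Omega>" for f x
      proof -
        obtain u where u: "u \<in> B" "u \<in> L2 \<Omega>" "f = G (L2_rep u)" using f B cont_rep by auto
        have "norm (shrink_lim (\<lambda>A. avg A (S (L2_rep u))) x) \<le> C * nrm \<Omega> (L2_rep u)"
          by (intro norm_shrink_lim_le osc rep x u C)
        also have "\<dots> \<le> C * R" unfolding R_def by (intro mult_left_mono R u C)
        finally show ?thesis using x u by (simp add: G_def)
      qed
      fix e :: real assume "0 < e"
      then have "0 < e / R" using \<open>0 < R\<close> by simp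
      from kernel_imp_small_osc[OF K SS this] obtain d where d: "0 < d"
        "\<And>f. f \<in> sq \<Longrightarrow> small_osc (\<lambda>A. avg A (S f)) d (e / R * nrm \<Omega> f)"
        by blast
      have "dist (G (L2_rep u) x) (G (L2_rep u) y) \<le> e"
        if u: "u \<in> B" and xy: "x \<in> closure \<Omega>" "y \<in> closure \<Omega>" "dist x y < d" for u x y
      proof -
        have f: "L2_rep u \<in> sq" using u B rep by auto
        have "e / R * nrm \<Omega> (L2_rep u) \<le> e / R * R"
          using R[OF u] \<open>0 < e / R\<close> unfolding R_def by (intro mult_left_mono) auto
        then have "small_osc (\<lambda>A. avg A (S (L2_rep u))) d e"
          using small_osc_mono[OF d(2)[OF f]] \<open>0 < R\<close> by simp
        then show ?thesis
          using dist_shrink_lim_shrink_lim_le[OF osc[OF f] xy(1,2) _ xy(3)] xy by (simp add: G_def)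
      qed
      then show "\<exists>d>0. \<forall>f\<in>(\<lambda>u. cont_rep \<Omega> (T u)) ` B. \<forall>x\<in>closure \<Omega>. \<forall>y\<in>closure \<Omega>.
          dist x y < d \<longrightarrow> dist (f x) (f y) \<le> e"
        using d(1) B cont_rep by (intro exI[of _ d]) (auto simp: subset_iff)
    qed
  qed
qed

end

section \<open>From compactness to the kernel\<close>

locale compact_self_adjoint_operator = self_adjoint_operator \<Omega> T
  for \<Omega> :: "'a::euclidean_space set" and T +
  assumes subset_C: "L2_subset_C \<Omega> (T ` L2 \<Omega>)"
    and compact_op: "compact_operator_L2 \<Omega> (C_closure \<Omega>) (\<lambda>u. cont_rep \<Omega> (T u))"
begin

text \<open>Unlike \<open>S\<close>, this choice has meaningful values at every point of the
  closure, and it is linear there.\<close>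

definition S_cont :: "('a \<Rightarrow> complex) \<Rightarrow> 'a \<Rightarrow> complex" where
  "S_cont f = cont_rep \<Omega> (T (L2_class \<Omega> f))"

lemma S_cont_mem:
  assumes f: "f \<in> sq"
  shows "S_cont f \<in> mspace (C_closure \<Omega>)" "S_cont f \<in> T (L2_class \<Omega> f)"
proof -
  obtain g where "g \<in> mspace (C_closure \<Omega>)" "g \<in> T (L2_class \<Omega> f)"
    using subset_C L2_class_in_L2[OF f] by (auto simp: L2_subset_C_def)
  moreover from this have "S_cont f = g"
    unfolding S_cont_def by (intro cont_rep_eqI open_dom bounded_dom T_in_L2 L2_class_in_L2 f)
  ultimately show "S_cont f \<in> mspace (C_closure \<Omega>)" "S_cont f \<in> T (L2_class \<Omega> f)" by auto
qed

lemma S_cont_continuous: "f \<in> sq \<Longrightarrow> continuous_on (closure \<Omega>) (S_cont f)"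
  using S_cont_mem(1) by (simp add: mspace_C_closure bounded_dom)

lemma S_cont_sq: "f \<in> sq \<Longrightarrow> S_cont f \<in> sq"
  by (rule continuous_square_integrable[OF S_cont_continuous])

lemma S_eq_S_cont: "f \<in> sq \<Longrightarrow> AE x in lebesgue_on \<Omega>. S f x = S_cont f x"
  using L2_members[OF T_in_L2[OF L2_class_in_L2] S_in_T] S_cont_mem(2) by simp

text \<open>Continuous representatives are unique, so identities that hold almost everywhere for
  \<open>S\<close> become identities at every point of the closure.\<close>

lemma S_cont_eqI:
  assumes f: "f \<in> sq" and h: "continuous_on (closure \<Omega>) h"
    and eq: "AE x in lebesgue_on \<Omega>. S f x = h x" and x: "x \<in> closure \<Omega>"
  shows "S_cont f x = h x"
proof -
  have cont: "continuous_on (closure \<Omega>) (restrict h (closure \<Omega>))"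
    using h by (simp cong: continuous_on_cong)
  have "AE x in lebesgue_on \<Omega>. S f x = restrict h (closure \<Omega>) x"
    using eq AE_space by eventually_elim (use closure_subset[of \<Omega>] in auto)
  then have "restrict h (closure \<Omega>) \<in> T (L2_class \<Omega> f)"
    using L2_members[OF T_in_L2[OF L2_class_in_L2[OF f]] S_in_T[OF f]] continuous_square_integrable[OF cont]
    by simp
  then have "S_cont f = restrict h (closure \<Omega>)"
    unfolding S_cont_def using cont
    by (intro cont_rep_eqI open_dom bounded_dom T_in_L2 L2_class_in_L2 f) (simp add: mspace_C_closure bounded_dom)
  with x show ?thesis by simp
qed

lemma S_cont_diff:
  assumes f: "f \<in> sq" and g: "g \<in> sq" and x: "x \<in> closure \<Omega>"
  shows "S_cont (\<lambda>x. f x - g x) x = S_cont f x - S_cont g x"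
proof (rule S_cont_eqI[OF square_integrable_diff[OF f g] _ _ x])
  show "continuous_on (closure \<Omega>) (\<lambda>x. S_cont f x - S_cont g x)"
    by (intro continuous_intros S_cont_continuous f g)
  show "AE x in lebesgue_on \<Omega>. S (\<lambda>x. f x - g x) x = S_cont f x - S_cont g x"
    using S_diff[OF f g] S_eq_S_cont[OF f] S_eq_S_cont[OF g] by eventually_elim simp
qed

lemma S_cont_scale:
  assumes f: "f \<in> sq" and x: "x \<in> closure \<Omega>"
  shows "S_cont (\<lambda>x. a * f x) x = a * S_cont f x"
proof (rule S_cont_eqI[OF square_integrable_scale[OF f] _ _ x])
  show "continuous_on (closure \<Omega>) (\<lambda>x. a * S_cont f x)"
    by (intro continuous_intros S_cont_continuous f)
  show "AE x in lebesgue_on \<Omega>. S (\<lambda>x. a * f x) x = a * S_cont f x"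
    using S_scale[OF f] S_eq_S_cont[OF f] by eventually_elim simp
qed

text \<open>The image of the closed unit ball has compact closure, which yields a common bound and a
  common modulus of continuity.\<close>

lemma unit_ball_bounds:
  shows "\<exists>C. \<forall>f\<in>sq. nrm \<Omega> f \<le> 1 \<longrightarrow> (\<forall>x\<in>closure \<Omega>. norm (S_cont f x) \<le> C)"
    and "0 < e \<Longrightarrow> \<exists>d>0. \<forall>f\<in>sq. nrm \<Omega> f \<le> 1 \<longrightarrow>
      (\<forall>x\<in>closure \<Omega>. \<forall>y\<in>closure \<Omega>. dist x y < d \<longrightarrow> dist (S_cont f x) (S_cont f y) \<le> e)"
proof -
  define B where "B = {u \<in> L2 \<Omega>. L2_norm \<Omega> u \<le> 1}"
  define F where "F = (\<lambda>u. cont_rep \<Omega> (T u)) ` B"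
  have F: "F \<subseteq> mspace (C_closure \<Omega>)"
    using compact_op by (auto simp: compact_operator_L2_def F_def B_def)
  have "B \<subseteq> L2 \<Omega>" "\<forall>u\<in>B. L2_norm \<Omega> u \<le> 1" by (auto simp: B_def)
  then have comp: "compactin (mtopology_of (C_closure \<Omega>)) (mtopology_of (C_closure \<Omega>) closure_of F)"
    using compact_op unfolding compact_operator_L2_def F_def by blast
  have mem: "S_cont f \<in> F" if "f \<in> sq" "nrm \<Omega> f \<le> 1" for f
  proof -
    have "L2_class \<Omega> f \<in> B"
      using that L2_norm_eq_nrm[OF L2_class_in_L2 mem_L2_class, of f \<Omega>] by (simp add: B_def L2_class_in_L2)
    then show ?thesis by (simp add: F_def S_cont_def)
  qed
  show "\<exists>C. \<forall>f\<in>sq. nrm \<Omega> f \<le> 1 \<longrightarrow> (\<forall>x\<in>closure \<Omega>. norm (S_cont f x) \<le> C)"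
    using compact_closure_imp_equicontinuous(1)[OF bounded_dom F comp] mem by meson
  show "\<exists>d>0. \<forall>f\<in>sq. nrm \<Omega> f \<le> 1 \<longrightarrow>
      (\<forall>x\<in>closure \<Omega>. \<forall>y\<in>closure \<Omega>. dist x y < d \<longrightarrow> dist (S_cont f x) (S_cont f y) \<le> e)" if "0 < e"
    using compact_closure_imp_equicontinuous(2)[OF bounded_dom F comp that] mem by meson
qed

text \<open>Rescaling into the unit ball. The functional \<open>p\<close> will be the size of a
  value of \<open>S_cont\<close>, or the distance between two of its values.\<close>

lemma le_mult_nrm_if_le_on_unit_ball:
  assumes f: "f \<in> sq" and C: "0 \<le> C"
    and le: "\<And>g. g \<in> sq \<Longrightarrow> nrm \<Omega> g \<le> 1 \<Longrightarrow> p g \<le> C"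
    and hom: "\<And>r. 0 < r \<Longrightarrow> p (\<lambda>x. of_real r * f x) = r * p f"
  shows "p f \<le> C * nrm \<Omega> f"
proof -
  have "p f - C * nrm \<Omega> f \<le> \<eta> * C" if "0 < \<eta>" for \<eta>
  proof -
    \<comment> \<open>Scaling by slightly more than the norm also covers functions of norm zero;
      \<eta> tends to zero at the end.\<close>
    define s where "s = nrm \<Omega> f + \<eta>"
    have s: "0 < s" "nrm \<Omega> f \<le> s"
      using that nrm_nonneg[of \<Omega> f] by (auto simp: s_def intro: add_nonneg_pos)
    have "nrm \<Omega> (\<lambda>x. of_real (1 / s) * f x) \<le> 1"
      using s unfolding nrm_scale by (simp add: norm_divide)
    then have "p (\<lambda>x. of_real (1 / s) * f x) \<le> C"
      by (intro le square_integrable_scale f)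
    also have "p (\<lambda>x. of_real (1 / s) * f x) = 1 / s * p f"
      using s by (intro hom) simp
    finally have "p f \<le> C * s" using s by (simp add: field_simps)
    then show ?thesis by (simp add: s_def algebra_simps)
  qed
  then show ?thesis using nonpos_if_le_mult_all[of "p f - C * nrm \<Omega> f" C] by simp
qed

lemma S_cont_bounded:
  obtains C where "0 \<le> C" "\<And>f x. f \<in> sq \<Longrightarrow> x \<in> closure \<Omega> \<Longrightarrow> norm (S_cont f x) \<le> C * nrm \<Omega> f"
proof -
  obtain C where C: "\<And>f x. f \<in> sq \<Longrightarrow> nrm \<Omega> f \<le> 1 \<Longrightarrow> x \<in> closure \<Omega> \<Longrightarrow> norm (S_cont f x) \<le> C"
    using unit_ball_bounds(1) by meson
  have "norm (S_cont f x) \<le> max C 0 * nrm \<Omega> f" if f: "f \<in> sq" and x: "x \<in> closure \<Omega>" for f x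
  proof (rule le_mult_nrm_if_le_on_unit_ball[OF f, where p = "\<lambda>f. norm (S_cont f x)"])
    show "norm (S_cont g x) \<le> max C 0" if "g \<in> sq" "nrm \<Omega> g \<le> 1" for g
      using C[OF that x] by simp
  qed (use f x in \<open>simp_all add: S_cont_scale norm_mult\<close>)
  then show ?thesis using that[of "max C 0"] by simp
qed

lemma S_cont_equicontinuous:
  assumes "0 < e"
  obtains d where "0 < d" "\<And>f x y. f \<in> sq \<Longrightarrow> x \<in> closure \<Omega> \<Longrightarrow> y \<in> closure \<Omega> \<Longrightarrow> dist x y < d
    \<Longrightarrow> dist (S_cont f x) (S_cont f y) \<le> e * nrm \<Omega> f"
proof -
  obtain d where "0 < d" and d: "\<And>f x y. f \<in> sq \<Longrightarrow> nrm \<Omega> f \<le> 1 \<Longrightarrow> x \<in> closure \<Omega> \<Longrightarrow> y \<in> closure \<Omega>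
      \<Longrightarrow> dist x y < d \<Longrightarrow> dist (S_cont f x) (S_cont f y) \<le> e"
    using unit_ball_bounds(2)[OF assms] by meson
  have "dist (S_cont f x) (S_cont f y) \<le> e * nrm \<Omega> f"
    if f: "f \<in> sq" and xy: "x \<in> closure \<Omega>" "y \<in> closure \<Omega>" "dist x y < d" for f x y
  proof (rule le_mult_nrm_if_le_on_unit_ball[OF f, where p = "\<lambda>f. dist (S_cont f x) (S_cont f y)"])
    show "dist (S_cont g x) (S_cont g y) \<le> e" if "g \<in> sq" "nrm \<Omega> g \<le> 1" for g
      using d[OF that xy] .
    show "dist (S_cont (\<lambda>x. of_real r * f x) x) (S_cont (\<lambda>x. of_real r * f x) y) = r * dist (S_cont f x) (S_cont f y)"
      if "0 < r" for r
      using f xy that by (simp add: S_cont_scale dist_norm norm_mult flip: right_diff_distrib)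
  qed (use assms in simp)
  with \<open>0 < d\<close> show ?thesis by (rule that)
qed

lemma avg_S_eq_avg_S_cont: "f \<in> sq \<Longrightarrow> A \<in> pos_sets \<Longrightarrow> avg A (S f) = avg A (S_cont f)"
  by (intro avg_cong_AE S_eq_S_cont square_integrableD(1) S_sq S_cont_sq)

text \<open>The averages \<open>phi A\<close> concentrated near a point \<open>x\<close> play the role of the Dirac mass at \<open>x\<close>:
  their images under \<open>T\<close> converge in \<open>L2 \<Omega>\<close>, hence their images under \<open>T\<^sup>2\<close> converge uniformly.\<close>

lemma S_cont_S_phi_small_osc:
  assumes "0 < e"
  obtains d where "0 < d" "\<And>y. y \<in> closure \<Omega> \<Longrightarrow> small_osc (\<lambda>A. S_cont (S (phi A)) y) d e"
proof -
  obtain C where C: "0 \<le> C" "\<And>f x. f \<in> sq \<Longrightarrow> x \<in> closure \<Omega> \<Longrightarrow> norm (S_cont f x) \<le> C * nrm \<Omega> f"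
    by (rule S_cont_bounded) blast
  \<comment> \<open>The final estimate multiplies by \<open>C\<close>, which may be zero.\<close>
  define e' where "e' = e / (C + 1)"
  have e': "0 < e'" "C * e' \<le> e" using C(1) assms by (auto simp: e'_def field_simps)
  obtain d where "0 < d" and d: "\<And>f x y. f \<in> sq \<Longrightarrow> x \<in> closure \<Omega> \<Longrightarrow> y \<in> closure \<Omega> \<Longrightarrow> dist x y < d
    \<Longrightarrow> dist (S_cont f x) (S_cont f y) \<le> e' * nrm \<Omega> f"
    using S_cont_equicontinuous[OF e'(1)] by blast
  have "small_osc (\<lambda>A. S_cont (S (phi A)) y) d e" if y: "y \<in> closure \<Omega>" for y
    unfolding small_osc_def
  proof (intro ballI impI)
    fix A B assume A: "A \<in> pos_sets" and B: "B \<in> pos_sets" and AB: "\<forall>a\<in>A. \<forall>b\<in>B. dist a b < d"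
    let ?psi = "\<lambda>x. phi A x - phi B x"
    have phi: "phi A \<in> sq" "phi B \<in> sq" by (intro phi_square_integrable A B)+
    have psi: "?psi \<in> sq" by (intro square_integrable_diff phi)
    have "nrm \<Omega> (S ?psi) \<le> e'"
    proof (rule nrm_S_phi_diff_le[OF A B])
      fix f assume f: "f \<in> sq"
      have "dist (avg A (S_cont f)) (avg B (S_cont f)) \<le> e' * nrm \<Omega> f"
        using AB pos_setsD(2)[OF A] pos_setsD(2)[OF B] closure_subset[of \<Omega>]
        by (intro dist_avg_avg_le square_integrable_imp_integrable S_cont_sq f A B d) auto
      then show "dist (avg A (S f)) (avg B (S f)) \<le> e' * nrm \<Omega> f"
        using f A B by (simp add: avg_S_eq_avg_S_cont)
    qed (use e' in simp)
    \<comment> \<open>The two functions agree only almost everywhere. The norm does not see the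
      difference, and the right-hand form is the one to which linearity of \<open>S_cont\<close>
      applies.\<close>
    moreover have "nrm \<Omega> (S ?psi) = nrm \<Omega> (\<lambda>x. S (phi A) x - S (phi B) x)"
      by (intro nrm_cong_AE S_diff phi square_integrableD(1) S_sq psi square_integrable_diff)
    ultimately have le: "nrm \<Omega> (\<lambda>x. S (phi A) x - S (phi B) x) \<le> e'" by simp
    have "dist (S_cont (S (phi A)) y) (S_cont (S (phi B)) y) = norm (S_cont (\<lambda>x. S (phi A) x - S (phi B) x) y)"
      using y phi by (simp add: S_cont_diff S_sq dist_norm)
    also have "\<dots> \<le> C * nrm \<Omega> (\<lambda>x. S (phi A) x - S (phi B) x)"
      by (intro C square_integrable_diff S_sq phi y)
    also have "\<dots> \<le> C * e'" by (intro mult_left_mono le C)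
    also have "\<dots> \<le> e" by (rule e')
    finally show "dist (S_cont (S (phi A)) y) (S_cont (S (phi B)) y) \<le> e" .
  qed
  with \<open>0 < d\<close> show ?thesis by (rule that)
qed

section \<open>The kernel as a limit\<close>

text \<open>The sets \<open>A\<close> shrink to the first variable while the second is held fixed.
  The conjugate is taken because \<open>S (S (phi A))\<close> will stand in the second, conjugated
  argument of the inner product.\<close>

definition lim_kernel :: "'a \<times> 'a \<Rightarrow> complex" where
  "lim_kernel = (\<lambda>(x, y). cnj (shrink_lim (\<lambda>A. S_cont (S (phi A)) y) x))"

lemma ex_small_osc: "y \<in> closure \<Omega> \<Longrightarrow> 0 < e \<Longrightarrow> \<exists>d>0. small_osc (\<lambda>A. S_cont (S (phi A)) y) d e"
  using S_cont_S_phi_small_osc by metis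

text \<open>One radius serves all \<open>x\<close> and \<open>y\<close>, since the oscillation bound
  is uniform in the evaluation point. Thus the approximation is uniform in \<open>y\<close>, and
  continuity in the first variable is uniform in the second.\<close>

lemma lim_kernel_approx:
  assumes "0 < e"
  obtains d where "0 < d" "\<And>x y A. x \<in> closure \<Omega> \<Longrightarrow> y \<in> closure \<Omega> \<Longrightarrow> A \<in> pos_sets \<Longrightarrow>
      (\<And>a. a \<in> A \<Longrightarrow> dist a x \<le> d) \<Longrightarrow> dist (cnj (S_cont (S (phi A)) y)) (lim_kernel (x, y)) \<le> e"
    "\<And>x x' y. x \<in> closure \<Omega> \<Longrightarrow> x' \<in> closure \<Omega> \<Longrightarrow> y \<in> closure \<Omega> \<Longrightarrow> dist x x' < d
      \<Longrightarrow> dist (lim_kernel (x, y)) (lim_kernel (x', y)) \<le> e"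
proof -
  have cnj: "dist (cnj z) (cnj w) = dist z w" for z w
    by (simp add: dist_norm flip: complex_cnj_diff)
  obtain d where "0 < d" and d: "\<And>y. y \<in> closure \<Omega> \<Longrightarrow> small_osc (\<lambda>A. S_cont (S (phi A)) y) d e"
    using S_cont_S_phi_small_osc[OF assms] by blast
  show ?thesis
  \<comment> \<open>Halving makes the non-strict condition on \<open>A\<close> leave the strict gap
    that the passage to the limit requires.\<close>
  proof (rule that[of "d / 2"])
    fix x y A assume "x \<in> closure \<Omega>" "y \<in> closure \<Omega>" "A \<in> pos_sets" "\<And>a. a \<in> A \<Longrightarrow> dist a x \<le> d / 2"
    then show "dist (cnj (S_cont (S (phi A)) y)) (lim_kernel (x, y)) \<le> e"
      using dist_shrink_lim_le[OF ex_small_osc _ d, of y x A "d / 2"] \<open>0 < d\<close> by (simp add: lim_kernel_def cnj)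
  next
    fix x x' y assume "x \<in> closure \<Omega>" "x' \<in> closure \<Omega>" "y \<in> closure \<Omega>" "dist x x' < d / 2"
    then show "dist (lim_kernel (x, y)) (lim_kernel (x', y)) \<le> e"
      using dist_shrink_lim_shrink_lim_le[OF ex_small_osc _ _ d, of y x x'] \<open>0 < d\<close> by (simp add: lim_kernel_def cnj)
  qed (use \<open>0 < d\<close> in simp)
qed

text \<open>First the first variable is moved, uniformly in the second. Then the second is moved by
  way of the continuous function \<open>k\<close>, which approximates the section at
  \<open>x\<close> uniformly. Four errors of \<open>e / 4\<close> arise, one of them strict.\<close>

lemma lim_kernel_continuous: "continuous_on (closure \<Omega> \<times> closure \<Omega>) lim_kernel"
  unfolding continuous_on_iff
proof (intro ballI allI impI)
  fix p and e :: real assume "p \<in> closure \<Omega> \<times> closure \<Omega>" "0 < e"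
  then obtain x y where p: "p = (x, y)" and xy: "x \<in> closure \<Omega>" "y \<in> closure \<Omega>" by auto
  have e: "0 < e / 4" using \<open>0 < e\<close> by simp
  obtain d where "0 < d" and d: "\<And>x y A. x \<in> closure \<Omega> \<Longrightarrow> y \<in> closure \<Omega> \<Longrightarrow> A \<in> pos_sets \<Longrightarrow>
      (\<And>a. a \<in> A \<Longrightarrow> dist a x \<le> d) \<Longrightarrow> dist (cnj (S_cont (S (phi A)) y)) (lim_kernel (x, y)) \<le> e / 4"
    "\<And>x x' y. x \<in> closure \<Omega> \<Longrightarrow> x' \<in> closure \<Omega> \<Longrightarrow> y \<in> closure \<Omega> \<Longrightarrow> dist x x' < d
      \<Longrightarrow> dist (lim_kernel (x, y)) (lim_kernel (x', y)) \<le> e / 4"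
    using lim_kernel_approx[OF e] by blast
  define A where "A = \<Omega> \<inter> ball x d"
  define k where "k y = cnj (S_cont (S (phi A)) y)" for y
  have A: "A \<in> pos_sets" using xy \<open>0 < d\<close> by (simp add: A_def ball_Int_in_pos_sets)
  have k: "dist (k y') (lim_kernel (x, y')) \<le> e / 4" if "y' \<in> closure \<Omega>" for y'
    unfolding k_def using d(1)[OF xy(1) that A] by (force simp: A_def dist_commute)
  have "continuous_on (closure \<Omega>) k"
    unfolding k_def by (intro continuous_intros S_cont_continuous S_sq phi_square_integrable A)
  then obtain d' where d': "0 < d'" "\<And>y'. y' \<in> closure \<Omega> \<Longrightarrow> dist y' y < d' \<Longrightarrow> dist (k y') (k y) < e / 4"
    using xy e unfolding continuous_on_iff by meson
  have "dist (lim_kernel q) (lim_kernel p) < e" if q: "q \<in> closure \<Omega> \<times> closure \<Omega>" "dist q p < min d d'" for q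
  proof -
    obtain x' y' where q': "q = (x', y')" and xy': "x' \<in> closure \<Omega>" "y' \<in> closure \<Omega>" using q by auto
    have "dist x' x < d" "dist y' y < d'"
      using q(2) dist_fst_le[of q p] dist_snd_le[of q p] by (auto simp: p q')
    note d(2)[OF xy'(1) xy(1) xy'(2) this(1)] d'(2)[OF xy'(2) this(2)]
    with k[OF xy'(2)] k[OF xy(2)] have "dist (lim_kernel (x', y')) (lim_kernel (x, y)) < e"
      using dist_triangle[of "lim_kernel (x', y')" "lim_kernel (x, y)" "lim_kernel (x, y')"]
        dist_triangle[of "lim_kernel (x, y')" "lim_kernel (x, y)" "k y'"] dist_triangle[of "k y'" "lim_kernel (x, y)" "k y"]
        dist_commute[of "k y'" "lim_kernel (x, y')"]
      by linarith
    then show ?thesis by (simp add: p q')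
  qed
  then show "\<exists>d>0. \<forall>q\<in>closure \<Omega> \<times> closure \<Omega>. dist q p < d \<longrightarrow> dist (lim_kernel q) (lim_kernel p) < e"
    using \<open>0 < d\<close> \<open>0 < d'\<close> by (intro exI[of _ "min d d'"]) auto
qed

text \<open>The value at \<open>x\<close> is nearly the average over a small set \<open>A\<close>
  about \<open>x\<close>. By self-adjointness this average is the pairing of \<open>f\<close> with
  the image of \<open>phi A\<close> under the squared operator, whose conjugate is uniformly close
  to the kernel section.\<close>

lemma S_cont_S_eq_integral:
  assumes f: "f \<in> sq" and x: "x \<in> \<Omega>"
  shows "S_cont (S f) x = (LINT y|lebesgue_on \<Omega>. lim_kernel (x, y) * f y)"
proof -
  define I where "I = (LINT y|lebesgue_on \<Omega>. cmod (f y))"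
  have x': "x \<in> closure \<Omega>" using x closure_subset by auto
  have sub: "y \<in> closure \<Omega>" if "y \<in> \<Omega>" for y using that closure_subset by auto
  have "continuous_on (closure \<Omega>) (\<lambda>y. cnj (lim_kernel (x, y)))"
    by (intro continuous_intros continuous_on_compose2[OF lim_kernel_continuous]) (use x' in auto)
  then have "integrable (lebesgue_on \<Omega>) (\<lambda>y. f y * cnj (cnj (lim_kernel (x, y))))"
    by (intro integrable_mult_cnj f continuous_square_integrable)
  then have int_kernel: "integrable (lebesgue_on \<Omega>) (\<lambda>y. lim_kernel (x, y) * f y)"
    by (simp add: mult.commute)
  have "dist (S_cont (S f) x) (LINT y|lebesgue_on \<Omega>. lim_kernel (x, y) * f y) \<le> e * (nrm \<Omega> (S f) + I)"
    if "0 < e" for e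
  proof -
    obtain d1 where d1: "0 < d1" "\<And>f x y. f \<in> sq \<Longrightarrow> x \<in> closure \<Omega> \<Longrightarrow> y \<in> closure \<Omega> \<Longrightarrow> dist x y < d1
        \<Longrightarrow> dist (S_cont f x) (S_cont f y) \<le> e * nrm \<Omega> f"
      using S_cont_equicontinuous[OF \<open>0 < e\<close>] by blast
    obtain d2 where "0 < d2" and d2: "\<And>x y A. x \<in> closure \<Omega> \<Longrightarrow> y \<in> closure \<Omega> \<Longrightarrow> A \<in> pos_sets \<Longrightarrow>
        (\<And>a. a \<in> A \<Longrightarrow> dist a x \<le> d2) \<Longrightarrow> dist (cnj (S_cont (S (phi A)) y)) (lim_kernel (x, y)) \<le> e"
      "\<And>x x' y. x \<in> closure \<Omega> \<Longrightarrow> x' \<in> closure \<Omega> \<Longrightarrow> y \<in> closure \<Omega> \<Longrightarrow> dist x x' < d2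
        \<Longrightarrow> dist (lim_kernel (x, y)) (lim_kernel (x', y)) \<le> e"
      using lim_kernel_approx[OF \<open>0 < e\<close>] by blast
    \<comment> \<open>Within \<open>d1\<close> the function \<open>S_cont (S f)\<close> is nearly
      constant; within \<open>d2\<close> the conjugate of \<open>k\<close> is close to the kernel
      section at \<open>x\<close>.\<close>
    define A where "A = \<Omega> \<inter> ball x (min d1 d2)"
    have A: "A \<in> pos_sets" using d1 \<open>0 < d2\<close> x' by (simp add: A_def ball_Int_in_pos_sets)
    define k where "k = S_cont (S (phi A))"
    have phi: "phi A \<in> sq" by (rule phi_square_integrable[OF A])
    have k_sq: "k \<in> sq" unfolding k_def by (intro S_cont_sq S_sq phi)
    have int_k: "integrable (lebesgue_on \<Omega>) (\<lambda>y. f y * cnj (k y))"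
      by (rule integrable_mult_cnj[OF f k_sq])
    have "dist (avg A (S_cont (S f))) (S_cont (S f) x) \<le> e * nrm \<Omega> (S f)"
    proof (intro dist_avg_le square_integrable_imp_integrable S_cont_sq S_sq f A AE_I2 impI)
      fix a assume "a \<in> A"
      then show "dist (S_cont (S f) a) (S_cont (S f) x) \<le> e * nrm \<Omega> (S f)"
        by (intro d1(2) S_sq f x') (auto simp: A_def sub dist_commute)
    qed
    also have "avg A (S_cont (S f)) = ip \<Omega> (S (S f)) (phi A)"
      using f A by (simp add: ip_phi avg_S_eq_avg_S_cont S_sq)
    \<comment> \<open>Self-adjointness is used twice, once for each factor of the squared
      operator.\<close>
    also have "\<dots> = ip \<Omega> f (S (S (phi A)))"
      using f phi by (simp add: ip_S S_sq)
    also have "\<dots> = ip \<Omega> f k"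
      using S_eq_S_cont[OF S_sq[OF phi]] by (intro ip_cong_AE f k_sq S_sq phi) (auto simp: k_def)
    finally have 1: "dist (ip \<Omega> f k) (S_cont (S f) x) \<le> e * nrm \<Omega> (S f)" .
    have "ip \<Omega> f k - (LINT y|lebesgue_on \<Omega>. lim_kernel (x, y) * f y)
        = (LINT y|lebesgue_on \<Omega>. f y * cnj (k y) - lim_kernel (x, y) * f y)"
      unfolding ip_def using int_k int_kernel by simp
    also have "cmod \<dots> \<le> (LINT y|lebesgue_on \<Omega>. e * cmod (f y))"
    proof (rule Bochner_Integration.integral_norm_bound_integral)
      show "integrable (lebesgue_on \<Omega>) (\<lambda>y. e * cmod (f y))"
        by (intro integrable_mult_right integrable_norm square_integrable_imp_integrable f)
      fix y assume "y \<in> space (lebesgue_on \<Omega>)"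
      then have y: "y \<in> closure \<Omega>" by (simp add: sub)
      have "f y * cnj (k y) - lim_kernel (x, y) * f y = (cnj (k y) - lim_kernel (x, y)) * f y"
        by (simp add: algebra_simps)
      moreover have "dist (cnj (k y)) (lim_kernel (x, y)) \<le> e"
        unfolding k_def by (intro d2(1) x' y A) (auto simp: A_def dist_commute)
      ultimately show "cmod (f y * cnj (k y) - lim_kernel (x, y) * f y) \<le> e * cmod (f y)"
        by (simp add: norm_mult dist_norm mult_right_mono)
    qed (use int_k int_kernel in simp)
    finally have "dist (ip \<Omega> f k) (LINT y|lebesgue_on \<Omega>. lim_kernel (x, y) * f y) \<le> e * I"
      by (simp add: dist_norm I_def)
    with 1 show ?thesis
      using dist_triangle3[of "S_cont (S f) x" "LINT y|lebesgue_on \<Omega>. lim_kernel (x, y) * f y" "ip \<Omega> f k"]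
      by (simp add: algebra_simps)
  qed
  \<comment> \<open>The factor \<open>nrm \<Omega> (S f) + I\<close> does not depend on
    \<open>e\<close>, so \<open>e\<close> can tend to zero.\<close>
  then have "dist (S_cont (S f) x) (LINT y|lebesgue_on \<Omega>. lim_kernel (x, y) * f y) \<le> 0"
    by (rule nonpos_if_le_mult_all)
  then show ?thesis by simp
qed

end

text \<open>Both implications are already available for functions; what remains is the passage from
  classes to arbitrary representatives.\<close>

theorem theorem3p9:
  fixes \<Omega> :: "(real ^ 'd::finite) set"
    and T :: "(real ^ 'd \<Rightarrow> complex) set \<Rightarrow> (real ^ 'd \<Rightarrow> complex) set"
  assumes "open \<Omega>" and "bounded \<Omega>"
    and "bounded_operator_L2 \<Omega> T" and "self_adjoint_L2 \<Omega> T"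
  shows "(\<exists>K :: (real ^ 'd) \<times> (real ^ 'd) \<Rightarrow> complex.
            continuous_on (closure \<Omega> \<times> closure \<Omega>) K \<and>
            (\<forall>u\<in>L2 \<Omega>. \<forall>f\<in>u. \<forall>g\<in>T (T u).
               AE x in lebesgue_on \<Omega>. g x = (LINT y|lebesgue_on \<Omega>. K (x, y) * f y)))
     \<longleftrightarrow> (L2_subset_C \<Omega> (T ` L2 \<Omega>) \<and>
          compact_operator_L2 \<Omega> (C_closure \<Omega>) (\<lambda>u. cont_rep \<Omega> (T u)))"
    (is "(\<exists>K. ?cont K \<and> ?int K) \<longleftrightarrow> ?R")
proof
  interpret self_adjoint_operator \<Omega> T by unfold_locales fact+
  assume "\<exists>K. ?cont K \<and> ?int K"
  then obtain K where K: "?cont K" "?int K" by blast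
  have "AE x in lebesgue_on \<Omega>. S (S f) x = (LINT y|lebesgue_on \<Omega>. K (x, y) * f y)" if f: "f \<in> sq" for f
  proof -
    have "S (S f) \<in> T (T (L2_class \<Omega> f))"
      using S_in_T[OF S_sq[OF f]] by (simp add: L2_class_S f)
    with K(2) L2_class_in_L2[OF f] mem_L2_class[OF f] show ?thesis by simp
  qed
  from kernel_imp_compact[OF K(1) this] show ?R by (rule conjI)
next
  assume ?R
  then interpret compact_self_adjoint_operator \<Omega> T by unfold_locales (use assms in auto)
  have "?int lim_kernel"
  proof (intro ballI)
    fix u f g assume u: "u \<in> L2 \<Omega>" "f \<in> u" "g \<in> T (T u)"
    have f: "f \<in> sq" using L2_rep_props(2)[OF u(1,2)] .
    have "T (T u) = T (L2_class \<Omega> (S f))"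
      using u by (simp add: L2_class_S f L2_class_eqI)
    \<comment> \<open>An arbitrary representative \<open>g\<close> differs from the continuous one
      only on a null set, and for the continuous one the integral formula holds at every point of
      \<Omega>.\<close>
    then have "AE x in lebesgue_on \<Omega>. S_cont (S f) x = g x"
      using L2_members[OF T_in_L2[OF L2_class_in_L2[OF S_sq[OF f]]] S_cont_mem(2)[OF S_sq[OF f]]] u(3) by simp
    then show "AE x in lebesgue_on \<Omega>. g x = (LINT y|lebesgue_on \<Omega>. lim_kernel (x, y) * f y)"
      using AE_space by eventually_elim (simp add: S_cont_S_eq_integral f)
  qed
  with lim_kernel_continuous show "\<exists>K. ?cont K \<and> ?int K" by (intro exI conjI)
qed

end
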